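(* Let $\mathcal{B}$ be a smooth $2$-dimensional manifold, $\Omega$ the canonical symplectic form on $T^*\mathcal{B}$, $(\Omega,\alpha)$ a non-degenerate Monge-Ampère structure on $T^*\mathcal{B}$, and $\rho=|\mathrm{Pf}(\alpha)|^{-1/2}\,\pi_\Omega^\#\circ\alpha_\#\in\mathrm{End}(TT^*\mathcal{B})$. Let $\epsilon_1,\epsilon_2,\epsilon_3\in\{-1,1\}$ and $$\mathbb{J}_\rho=\begin{pmatrix}\rho&0\\0&\epsilon_1\rho^*\end{pmatrix},\quad \mathbb{J}_\alpha=\begin{pmatrix}0&\pi_\alpha^\#\\ \epsilon_2\alpha_\#&0\end{pmatrix},\quad \mathbb{J}_\Omega=\begin{pmatrix}0&\pi_\Omega^\#\\ \epsilon_3\Omega_\#&0\end{pmatrix}.$$ If the structure is elliptic or hyperbolic, these are generalized almost structures on $T^*\mathcal{B}$, and: 1. If $\mathrm{Pf}(\alpha)>0$ (elliptic), then $\mathbb{J}_\rho$ is a GaAC structure for $\epsilon_1=1$ and a GaC structure for $\epsilon_1=-1$. 2. If $\mathrm{Pf}(\alpha)<0$ (hyperbolic), then $\mathbb{J}_\rho$ is a GaP structure for $\epsilon_1=1$ and a GaPC structure for $\epsilon_1=-1$. 3. The types of $\mathbb{J}_\alpha$ and $\mathbb{J}_\Omega$ are independent of $\mathrm{sgn}(\mathrm{Pf}(\alpha))$ and are determined by $\epsilon_2$ and $\epsilon_3$, respectively: $\mathbb{J}_\alpha$ is GaPC if $\epsilon_2=1$ and GaC if $\epsilon_2=-1$;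 $\mathbb{J}_\Omega$ is GaPC if $\epsilon_3=1$ and GaC if $\epsilon_3=-1$. The two structures never coincide: $\mathbb{J}_\alpha\neq\mathbb{J}_\Omega$.
   Context: Manifolds are nonempty. In Darboux coordinates $x,y,p,q$ on $T^*\mathcal{B}$, $\Omega=dx\wedge dp+dy\wedge dq$. A (symplectic) Monge-Ampère structure on $T^*\mathcal{B}$ is a pair $(\Omega,\alpha)$ with $\alpha\in\Omega^2(T^*\mathcal{B})$ and $\Omega\wedge\alpha=0$. Its Pfaffian is the function $\mathrm{Pf}(\alpha)$ with $\alpha\wedge\alpha=\mathrm{Pf}(\alpha)\,\Omega\wedge\Omega$; the structure is non-degenerate if $\mathrm{Pf}(\alpha)$ is nowhere zero (then $\alpha$ is a non-degenerate $2$-form), elliptic if $\mathrm{Pf}(\alpha)>0$, hyperbolic if $\mathrm{Pf}(\alpha)<0$. For a $2$-form $\sigma$, $\sigma_\#:T\mathcal{M}\to T^*\mathcal{M}$ is $\sigma_\#(X)=\sigma(X,\cdot)$; if $\sigma$ is non-degenerate, $\pi_\sigma^\#:=(\sigma_\#)^{-1}:T^*\mathcal{M}\to T\mathcal{M}$. For $A\in\mathrm{End}(T\mathcal{M})$, $A^*\in\mathrm{End}(T^*\mathcal{M})$ is the dual map. $\mathbb{T}\mathcal{M}=T\mathcal{M}\oplus T^*\mathcal{M}$ carries the pairing $\eta((X,\xi),(Y,\zeta))=\frac12(\xi(Y)+\zeta(X))$. A generalized almost structure on $\mathcal{M}$ is a bundle map $\mathbb{J}:\mathbb{T}\mathcal{M}\to\mathbb{T}\mathcal{M}$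 with $\mathbb{J}^2=\gamma_1\mathrm{Id}$ and $\mathbb{J}^\bullet\eta=\gamma_2\eta$, where $\gamma_1,\gamma_2\in\{-1,1\}$ and $\mathbb{J}^\bullet\eta(u,v)=\eta(\mathbb{J}u,\mathbb{J}v)$. It is called GaP (generalized almost product) if $(\gamma_1,\gamma_2)=(1,1)$, GaPC (generalized almost para-complex) if $(1,-1)$, GaC (generalized almost complex) if $(-1,1)$, GaAC (generalized almost anti-complex) if $(-1,-1)$. Block matrices are with respect to $\mathbb{T}\mathcal{M}=T\mathcal{M}\oplus T^*\mathcal{M}$; here $\mathcal{M}=T^*\mathcal{B}$. *)

theory Defs
  imports "HOL-Analysis.Analysis" "HOL-Library.Function_Algebras"
begin

section \<open>Pointwise vector space structure on functions\<close>

instantiation "fun" :: (type, real_vector) real_vector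
begin

definition scaleR_fun :: "real \<Rightarrow> ('a \<Rightarrow> 'b) \<Rightarrow> 'a \<Rightarrow> 'b"
  where "scaleR_fun r f = (\<lambda>x. r *\<^sub>R f x)"

instance
  by standard (auto simp: scaleR_fun_def plus_fun_def fun_eq_iff scaleR_add_right scaleR_add_left)

end

definition linear_on :: "'v::real_vector set \<Rightarrow> ('v \<Rightarrow> 'w::real_vector) \<Rightarrow> bool"
  where "linear_on S f \<longleftrightarrow>
    (\<forall>x\<in>S. \<forall>y\<in>S. f (x + y) = f x + f y) \<and> (\<forall>r. \<forall>x\<in>S. f (r *\<^sub>R x) = r *\<^sub>R f x)"


section \<open>Smooth functions and smooth manifolds\<close>

text \<open>Intended for open \<open>S\<close>, where only the values of \<open>f\<close> on \<open>S\<close> matter; for finite-dimensional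
  \<open>'e\<close> this is the usual class \<open>C\<^sup>k\<close>.\<close>

primrec C_k_on :: "nat \<Rightarrow> ('e::real_normed_vector \<Rightarrow> 'f::real_normed_vector) \<Rightarrow> 'e set \<Rightarrow> bool"
  where
    "C_k_on 0 f S \<longleftrightarrow> continuous_on S f"
  | "C_k_on (Suc k) f S \<longleftrightarrow> (\<forall>x\<in>S. f differentiable (at x)) \<and>
       (\<forall>v. C_k_on k (\<lambda>x. frechet_derivative f (at x) v) S)"

definition smooth_on :: "('e::real_normed_vector \<Rightarrow> 'f::real_normed_vector) \<Rightarrow> 'e set \<Rightarrow> bool"
  where "smooth_on f S \<longleftrightarrow> (\<forall>k. C_k_on k f S)"

text \<open>A chart is its domain together with its coordinate map, which is irrelevant off the domain.\<close>

type_synonym ('p, 'e) chart = "'p set \<times> ('p \<Rightarrow> 'e)"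

definition chart_inv :: "('p, 'e) chart \<Rightarrow> 'e \<Rightarrow> 'p"
  where "chart_inv c = inv_into (fst c) (snd c)"

definition chart_range :: "('p, 'e) chart \<Rightarrow> 'e set"
  where "chart_range c = snd c ` fst c"

definition transition :: "('p, 'e) chart \<Rightarrow> ('p, 'e) chart \<Rightarrow> 'e \<Rightarrow> 'e"
  where "transition c d = snd d \<circ> chart_inv c"

definition carrier :: "('p, 'e) chart set \<Rightarrow> 'p set"
  where "carrier M = (\<Union>c\<in>M. fst c)"

definition smooth_atlas :: "('p, 'e::euclidean_space) chart set \<Rightarrow> bool"
  where "smooth_atlas M \<longleftrightarrow>
    (\<forall>c\<in>M. inj_on (snd c) (fst c) \<and> open (chart_range c)) \<and>
    (\<forall>c\<in>M. \<forall>d\<in>M. open (snd c ` (fst c \<inter> fst d)) \<and>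
       smooth_on (transition c d) (snd c ` (fst c \<inter> fst d)))"

text \<open>The topology for which all charts are homeomorphisms from open sets onto open sets.\<close>

definition manifold_topology :: "('p, 'e::euclidean_space) chart set \<Rightarrow> 'p topology"
  where "manifold_topology M =
    topology_generated_by {W. \<exists>c\<in>M. W \<subseteq> fst c \<and> open (snd c ` W)}"

text \<open>A manifold is presented by an atlas, which determines its underlying set (the union of the
  chart domains), its topology, and its smooth structure.  Its dimension is \<open>DIM('e)\<close>.\<close>

definition smooth_manifold :: "('p, 'e::euclidean_space) chart set \<Rightarrow> bool"
  where "smooth_manifold M \<longleftrightarrow> smooth_atlas M \<and> carrier M \<noteq> {} \<and>
    Hausdorff_space (manifold_topology M) \<and> second_countable (manifold_topology M)"


section \<open>Tangent and cotangent spaces\<close>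

text \<open>A tangent vector at \<open>p\<close> is the family of its coordinate representations in the charts
  around \<open>p\<close>, related by the derivatives of the transition maps; the entries at all other charts
  are 0.  The vector space operations are pointwise.\<close>

type_synonym ('p, 'e) tvec = "('p, 'e) chart \<Rightarrow> 'e"

definition tangent_space :: "('p, 'e::euclidean_space) chart set \<Rightarrow> 'p \<Rightarrow> ('p, 'e) tvec set"
  where "tangent_space M p = {v.
    (\<forall>c\<in>M. \<forall>d\<in>M. p \<in> fst c \<longrightarrow> p \<in> fst d \<longrightarrow>
       v d = frechet_derivative (transition c d) (at (snd c p)) (v c)) \<and>
    (\<forall>c. \<not> (c \<in> M \<and> p \<in> fst c) \<longrightarrow> v c = 0)}"

text \<open>For \<open>c \<in> M\<close> with \<open>p\<close> in its domain, \<open>coord_vec M c p e\<close> is the tangent vector at \<open>p\<close> whose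
  representation in \<open>c\<close> is \<open>e\<close>; for \<open>e \<in> Basis\<close> it is a coordinate vector field of \<open>c\<close> at \<open>p\<close>.\<close>

definition coord_vec ::
    "('p, 'e::euclidean_space) chart set \<Rightarrow> ('p, 'e) chart \<Rightarrow> 'p \<Rightarrow> 'e \<Rightarrow> ('p, 'e) tvec"
  where "coord_vec M c p e = (\<lambda>d. if d \<in> M \<and> p \<in> fst d
    then frechet_derivative (transition c d) (at (snd c p)) e else 0)"

text \<open>Covectors at \<open>p\<close> are the linear functionals on the tangent space at \<open>p\<close>, extended by 0 so that
  equality of covectors is equality of functions.\<close>

type_synonym ('p, 'e) covec = "('p, 'e) tvec \<Rightarrow> real"

definition cotangent_space :: "('p, 'e::euclidean_space) chart set \<Rightarrow> 'p \<Rightarrow> ('p, 'e) covec set"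
  where "cotangent_space M p = {\<xi>. linear_on (tangent_space M p) \<xi> \<and>
    (\<forall>v. v \<notin> tangent_space M p \<longrightarrow> \<xi> v = 0)}"


section \<open>The cotangent bundle as a manifold\<close>

type_synonym ('p, 'e) cotangent_point = "'p \<times> ('p, 'e) covec"

text \<open>The chart \<open>(x, p)\<close> of the cotangent bundle induced by a chart \<open>x\<close> of the base:
  \<open>p\<close> has components \<open>\<xi> (\<partial>/\<partial>x\<^sub>i)\<close>.\<close>

definition cotangent_chart :: "('p, 'e::euclidean_space) chart set \<Rightarrow> ('p, 'e) chart
    \<Rightarrow> (('p, 'e) cotangent_point, 'e \<times> 'e) chart"
  where "cotangent_chart A c =
    ({(p, \<xi>). p \<in> fst c \<and> \<xi> \<in> cotangent_space A p},
     \<lambda>(p, \<xi>). (snd c p, \<Sum>b\<in>Basis. \<xi> (coord_vec A c p b) *\<^sub>R b))"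

definition cotangent_atlas ::
    "('p, 'e::euclidean_space) chart set \<Rightarrow> (('p, 'e) cotangent_point, 'e \<times> 'e) chart set"
  where "cotangent_atlas A = cotangent_chart A ` A"


section \<open>2-forms\<close>

text \<open>Only the values of a 2-form at points of the manifold and on tangent vectors are
  meaningful.\<close>

type_synonym ('p, 'e) two_form = "'p \<Rightarrow> ('p, 'e) tvec \<Rightarrow> ('p, 'e) tvec \<Rightarrow> real"

definition two_form :: "('p, 'e::euclidean_space) chart set \<Rightarrow> ('p, 'e) two_form \<Rightarrow> bool"
  where "two_form M \<sigma> \<longleftrightarrow>
    (\<forall>z\<in>carrier M.
       (\<forall>X\<in>tangent_space M z. linear_on (tangent_space M z) (\<sigma> z X)) \<and>
       (\<forall>Y\<in>tangent_space M z. linear_on (tangent_space M z) (\<lambda>X. \<sigma> z X Y)) \<and>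
       (\<forall>X\<in>tangent_space M z. \<sigma> z X X = 0)) \<and>
    (\<forall>c\<in>M. \<forall>e f. smooth_on
       (\<lambda>x. let z = chart_inv c x in \<sigma> z (coord_vec M c z e) (coord_vec M c z f)) (chart_range c))"

text \<open>Sum over the (2,2)-shuffles, with the usual signs.\<close>

definition wedge :: "('v \<Rightarrow> 'v \<Rightarrow> real) \<Rightarrow> ('v \<Rightarrow> 'v \<Rightarrow> real) \<Rightarrow> 'v \<Rightarrow> 'v \<Rightarrow> 'v \<Rightarrow> 'v \<Rightarrow> real"
  where "wedge \<sigma> \<tau> X1 X2 X3 X4 =
      \<sigma> X1 X2 * \<tau> X3 X4 - \<sigma> X1 X3 * \<tau> X2 X4 + \<sigma> X1 X4 * \<tau> X2 X3
    + \<sigma> X2 X3 * \<tau> X1 X4 - \<sigma> X2 X4 * \<tau> X1 X3 + \<sigma> X3 X4 * \<tau> X1 X2"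

definition form_sharp :: "('p, 'e::euclidean_space) chart set \<Rightarrow> ('p, 'e) two_form
    \<Rightarrow> 'p \<Rightarrow> ('p, 'e) tvec \<Rightarrow> ('p, 'e) covec"
  where "form_sharp M \<sigma> z X = (\<lambda>Y. if Y \<in> tangent_space M z then \<sigma> z X Y else 0)"

text \<open>\<open>\<pi>\<^sub>\<sigma>\<^sup>#\<close>, meaningful for non-degenerate \<open>\<sigma>\<close>.\<close>

definition form_pi :: "('p, 'e::euclidean_space) chart set \<Rightarrow> ('p, 'e) two_form
    \<Rightarrow> 'p \<Rightarrow> ('p, 'e) covec \<Rightarrow> ('p, 'e) tvec"
  where "form_pi M \<sigma> z = inv_into (tangent_space M z) (form_sharp M \<sigma> z)"

definition dual_endo :: "('p, 'e::euclidean_space) chart set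
    \<Rightarrow> ('p \<Rightarrow> ('p, 'e) tvec \<Rightarrow> ('p, 'e) tvec) \<Rightarrow> 'p \<Rightarrow> ('p, 'e) covec \<Rightarrow> ('p, 'e) covec"
  where "dual_endo M F z \<xi> = (\<lambda>Y. if Y \<in> tangent_space M z then \<xi> (F z Y) else 0)"

text \<open>The form \<open>\<Sum>\<^sub>i dx\<^sub>i \<and> dp\<^sub>i\<close> in the coordinates \<open>(x, p)\<close> of any chart of the cotangent bundle
  around the point; the value does not depend on the chart chosen, because the transition maps
  between such charts are symplectic.\<close>

definition canonical_symplectic_form ::
    "('p, 'e::euclidean_space) chart set \<Rightarrow> (('p, 'e) cotangent_point, 'e \<times> 'e) two_form"
  where "canonical_symplectic_form A z X Y =
    (let c = (SOME c. c \<in> cotangent_atlas A \<and> z \<in> fst c)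
     in fst (X c) \<bullet> snd (Y c) - snd (X c) \<bullet> fst (Y c))"


section \<open>Generalized almost structures\<close>

definition gen_tangent_space ::
    "('p, 'e::euclidean_space) chart set \<Rightarrow> 'p \<Rightarrow> (('p, 'e) tvec \<times> ('p, 'e) covec) set"
  where "gen_tangent_space M z = tangent_space M z \<times> cotangent_space M z"

definition gen_pairing ::
    "('p, 'e) tvec \<times> ('p, 'e) covec \<Rightarrow> ('p, 'e) tvec \<times> ('p, 'e) covec \<Rightarrow> real"
  where "gen_pairing u v = (snd u (fst v) + snd v (fst u)) / 2"

text \<open>The trivialization of the generalized tangent bundle over a chart \<open>c\<close> and its inverse, with
  respect to the coordinate vector fields and their dual coordinate 1-forms.\<close>

definition gen_coord :: "('p, 'e::euclidean_space) chart set \<Rightarrow> ('p, 'e) chart \<Rightarrow> 'p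
    \<Rightarrow> ('p, 'e) tvec \<times> ('p, 'e) covec \<Rightarrow> 'e \<times> 'e"
  where "gen_coord M c z u = (fst u c, \<Sum>b\<in>Basis. snd u (coord_vec M c z b) *\<^sub>R b)"

definition gen_coord_inv :: "('p, 'e::euclidean_space) chart set \<Rightarrow> ('p, 'e) chart \<Rightarrow> 'p
    \<Rightarrow> 'e \<times> 'e \<Rightarrow> ('p, 'e) tvec \<times> ('p, 'e) covec"
  where "gen_coord_inv M c z w =
    (coord_vec M c z (fst w), \<lambda>Y. if Y \<in> tangent_space M z then snd w \<bullet> Y c else 0)"

type_synonym ('p, 'e) gen_endo =
  "'p \<Rightarrow> ('p, 'e) tvec \<times> ('p, 'e) covec \<Rightarrow> ('p, 'e) tvec \<times> ('p, 'e) covec"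

definition gen_bundle_map :: "('p, 'e::euclidean_space) chart set \<Rightarrow> ('p, 'e) gen_endo \<Rightarrow> bool"
  where "gen_bundle_map M J \<longleftrightarrow>
    (\<forall>z\<in>carrier M. J z ` gen_tangent_space M z \<subseteq> gen_tangent_space M z \<and>
       linear_on (gen_tangent_space M z) (J z)) \<and>
    (\<forall>c\<in>M. \<forall>w. smooth_on
       (\<lambda>x. let z = chart_inv c x in gen_coord M c z (J z (gen_coord_inv M c z w))) (chart_range c))"

definition gen_almost_type ::
    "('p, 'e::euclidean_space) chart set \<Rightarrow> real \<Rightarrow> real \<Rightarrow> ('p, 'e) gen_endo \<Rightarrow> bool"
  where "gen_almost_type M \<gamma>1 \<gamma>2 J \<longleftrightarrow> gen_bundle_map M J \<and>
    (\<forall>z\<in>carrier M.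
       (\<forall>u\<in>gen_tangent_space M z. J z (J z u) = \<gamma>1 *\<^sub>R u) \<and>
       (\<forall>u\<in>gen_tangent_space M z. \<forall>v\<in>gen_tangent_space M z.
          gen_pairing (J z u) (J z v) = \<gamma>2 * gen_pairing u v))"

definition gen_almost_structure ::
    "('p, 'e::euclidean_space) chart set \<Rightarrow> ('p, 'e) gen_endo \<Rightarrow> bool"
  where "gen_almost_structure M J \<longleftrightarrow> (\<exists>\<gamma>1\<in>{-1, 1}. \<exists>\<gamma>2\<in>{-1, 1}. gen_almost_type M \<gamma>1 \<gamma>2 J)"

definition GaP :: "('p, 'e::euclidean_space) chart set \<Rightarrow> ('p, 'e) gen_endo \<Rightarrow> bool"
  where "GaP M J \<longleftrightarrow> gen_almost_type M 1 1 J"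

definition GaPC :: "('p, 'e::euclidean_space) chart set \<Rightarrow> ('p, 'e) gen_endo \<Rightarrow> bool"
  where "GaPC M J \<longleftrightarrow> gen_almost_type M 1 (-1) J"

definition GaC :: "('p, 'e::euclidean_space) chart set \<Rightarrow> ('p, 'e) gen_endo \<Rightarrow> bool"
  where "GaC M J \<longleftrightarrow> gen_almost_type M (-1) 1 J"

definition GaAC :: "('p, 'e::euclidean_space) chart set \<Rightarrow> ('p, 'e) gen_endo \<Rightarrow> bool"
  where "GaAC M J \<longleftrightarrow> gen_almost_type M (-1) (-1) J"

text \<open>Equality as bundle maps, i.e. ignoring the values outside the generalized tangent bundle.\<close>

definition gen_endo_eq ::
    "('p, 'e::euclidean_space) chart set \<Rightarrow> ('p, 'e) gen_endo \<Rightarrow> ('p, 'e) gen_endo \<Rightarrow> bool"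
  where "gen_endo_eq M J K \<longleftrightarrow> (\<forall>z\<in>carrier M. \<forall>u\<in>gen_tangent_space M z. J z u = K z u)"


section \<open>Monge-Ampere structures on the cotangent bundle of a surface\<close>

type_synonym 'p surface_two_form = "(('p, real^2) cotangent_point, (real^2) \<times> (real^2)) two_form"

definition monge_ampere :: "('p, real^2) chart set \<Rightarrow> 'p surface_two_form \<Rightarrow> bool"
  where "monge_ampere A \<alpha> \<longleftrightarrow> two_form (cotangent_atlas A) \<alpha> \<and>
    (\<forall>z\<in>carrier (cotangent_atlas A).
       \<forall>X1\<in>tangent_space (cotangent_atlas A) z. \<forall>X2\<in>tangent_space (cotangent_atlas A) z.
       \<forall>X3\<in>tangent_space (cotangent_atlas A) z. \<forall>X4\<in>tangent_space (cotangent_atlas A) z.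
         wedge (canonical_symplectic_form A z) (\<alpha> z) X1 X2 X3 X4 = 0)"

definition Pf ::
    "('p, real^2) chart set \<Rightarrow> 'p surface_two_form \<Rightarrow> ('p, real^2) cotangent_point \<Rightarrow> real"
  where "Pf A \<alpha> z = (THE r.
       \<forall>X1\<in>tangent_space (cotangent_atlas A) z. \<forall>X2\<in>tangent_space (cotangent_atlas A) z.
       \<forall>X3\<in>tangent_space (cotangent_atlas A) z. \<forall>X4\<in>tangent_space (cotangent_atlas A) z.
         wedge (\<alpha> z) (\<alpha> z) X1 X2 X3 X4 =
         r * wedge (canonical_symplectic_form A z) (canonical_symplectic_form A z) X1 X2 X3 X4)"

definition ma_nondegenerate :: "('p, real^2) chart set \<Rightarrow> 'p surface_two_form \<Rightarrow> bool"
  where "ma_nondegenerate A \<alpha> \<longleftrightarrow> (\<forall>z\<in>carrier (cotangent_atlas A). Pf A \<alpha> z \<noteq> 0)"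

definition ma_elliptic :: "('p, real^2) chart set \<Rightarrow> 'p surface_two_form \<Rightarrow> bool"
  where "ma_elliptic A \<alpha> \<longleftrightarrow> (\<forall>z\<in>carrier (cotangent_atlas A). Pf A \<alpha> z > 0)"

definition ma_hyperbolic :: "('p, real^2) chart set \<Rightarrow> 'p surface_two_form \<Rightarrow> bool"
  where "ma_hyperbolic A \<alpha> \<longleftrightarrow> (\<forall>z\<in>carrier (cotangent_atlas A). Pf A \<alpha> z < 0)"

definition ma_rho :: "('p, real^2) chart set \<Rightarrow> 'p surface_two_form
    \<Rightarrow> ('p, real^2) cotangent_point
    \<Rightarrow> (('p, real^2) cotangent_point, (real^2) \<times> (real^2)) tvec
    \<Rightarrow> (('p, real^2) cotangent_point, (real^2) \<times> (real^2)) tvec"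
  where "ma_rho A \<alpha> z X = \<bar>Pf A \<alpha> z\<bar> powr (-1/2) *\<^sub>R
    form_pi (cotangent_atlas A) (canonical_symplectic_form A) z
      (form_sharp (cotangent_atlas A) \<alpha> z X)"

definition J_endo :: "('p, 'e::euclidean_space) chart set
    \<Rightarrow> ('p \<Rightarrow> ('p, 'e) tvec \<Rightarrow> ('p, 'e) tvec) \<Rightarrow> real \<Rightarrow> ('p, 'e) gen_endo"
  where "J_endo M F \<epsilon> z = (\<lambda>(X, \<xi>). (F z X, \<epsilon> *\<^sub>R dual_endo M F z \<xi>))"

definition J_form ::
    "('p, 'e::euclidean_space) chart set \<Rightarrow> ('p, 'e) two_form \<Rightarrow> real \<Rightarrow> ('p, 'e) gen_endo"
  where "J_form M \<sigma> \<epsilon> z = (\<lambda>(X, \<xi>). (form_pi M \<sigma> z \<xi>, \<epsilon> *\<^sub>R form_sharp M \<sigma> z X))"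

end

theory Submission
  imports Defs
begin

text \<open>Cotangent lifts are symplectic by the symmetry of second derivatives, so \<open>\<Omega>\<close> is the constant
  standard form in every cotangent chart.  There \<open>\<Omega> \<and> \<alpha> = 0\<close> says that \<open>A = \<pi>\<^sub>\<Omega>\<^sup># \<circ> \<alpha>\<^sub>#\<close> is trace-free,
  which in dimension four forces \<open>A\<^sup>2 = - Pf(\<alpha>) Id\<close>.  Hence \<open>\<rho>\<^sup>2 = - sgn(Pf(\<alpha>)) Id\<close>, and \<open>\<alpha>\<^sub>#\<close> has the
  inverse \<open>- Pf(\<alpha>)\<inverse> A \<circ> \<pi>\<^sub>\<Omega>\<^sup>#\<close>, which is visibly smooth.  The types follow by duality and skewness.\<close>

section \<open>Calculus of smooth functions\<close>

text \<open>The quadratic relation has a structural reason. As \<Omega>(AX, Y) = \<alpha>(X, Y) and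
  both forms are skew, A is self-adjoint for \<Omega>. Its characteristic polynomial is therefore
  the square of the polynomial Pf(\<alpha> - t \<Omega>), and A is a root of the latter. In the
  square of \<alpha> - t \<Omega> the term linear in t is -2t \<Omega> \<and> \<alpha> = 0, which
  leaves t^2 + Pf(\<alpha>).

  The obstacle is that \<Omega>, Pf and the inverse of a form are given by a choice of chart, a
  definite description and \<open>inv_into\<close>, none of which exhibits linearity or smoothness.
  Each is first replaced by an explicit formula in an arbitrary chart
  (\<open>canonical_symplectic_form_chart\<close>, \<open>Pf_chart\<close>,
  \<open>form_pi_coord\<close>). The factor |Pf|^(-1/2) is smooth because Pf has a constant sign s
  in the elliptic and in the hyperbolic case, so that |Pf| = s Pf.

  Second derivatives occur because momenta transform by a first derivative of the base transition,
  which is differentiated once more in the derivative of the lift.\<close>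

lemma C_k_on_cong:
  assumes "open S" "\<And>x. x \<in> S \<Longrightarrow> f x = g x" "C_k_on k f S"
  shows "C_k_on k g S"
  using assms(2,3)
proof (induction k arbitrary: f g)
  case 0
  then show ?case
    using continuous_on_cong[of S S f g] by simp
next
  case (Suc k)
  have eq: "frechet_derivative g (at x) = frechet_derivative f (at x)" if "x \<in> S" for x
    using frechet_derivative_transform_within_open[of f x S g] Suc.prems that assms(1) by auto
  have "g differentiable (at x)" if "x \<in> S" for x
    using Suc.prems that has_derivative_transform_within_open[OF _ assms(1), of f _ x UNIV g]
    unfolding differentiable_def C_k_on.simps by metis
  moreover have "C_k_on k (\<lambda>x. frechet_derivative g (at x) v) S" for v
    using Suc.IH[of "\<lambda>x. frechet_derivative f (at x) v" "\<lambda>x. frechet_derivative g (at x) v"]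
      Suc.prems(2) eq by auto
  ultimately show ?case by simp
qed

text \<open>Uniqueness of derivatives lets an explicit \<open>f'\<close> replace the choice operator
  \<open>frechet_derivative\<close>, so the inductions below can run on the usual differentiation
  formulas.\<close>

lemma C_k_on_SucI:
  assumes "open S" "\<And>x. x \<in> S \<Longrightarrow> (f has_derivative f' x) (at x)"
    "\<And>v. C_k_on k (\<lambda>x. f' x v) S"
  shows "C_k_on (Suc k) f S"
proof -
  have "C_k_on k (\<lambda>x. frechet_derivative f (at x) v) S" for v
    by (rule C_k_on_cong[OF assms(1) _ assms(3)[of v]])
       (metis assms(2) frechet_derivative_at)
  then show ?thesis
    using assms(2) by (auto simp: differentiable_def)
qed

lemma C_k_on_has_derivative:
  assumes "C_k_on (Suc k) f S" "x \<in> S"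
  shows "(f has_derivative frechet_derivative f (at x)) (at x)"
  using assms frechet_derivative_works by auto

lemma C_k_on_SucD: "C_k_on (Suc k) f S \<Longrightarrow> C_k_on k f S"
proof (induction k arbitrary: f)
  case 0
  then show ?case
    by (auto intro!: continuous_at_imp_continuous_on differentiable_imp_continuous_within)
qed auto

lemma C_k_on_const: "open S \<Longrightarrow> C_k_on k (\<lambda>x. c) S"
proof (induction k arbitrary: c)
  case (Suc k)
  show ?case
    by (rule C_k_on_SucI[where f' = "\<lambda>x v. 0"]) (use Suc in auto)
qed simp

lemma C_k_on_bounded_linear:
  assumes "bounded_linear h" "open S" "C_k_on k f S"
  shows "C_k_on k (\<lambda>x. h (f x)) S"
  using assms(3)
proof (induction k arbitrary: f)
  case 0
  then show ?case
    using bounded_linear.continuous_on[OF assms(1)] by auto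
next
  case (Suc k)
  show ?case
  proof (rule C_k_on_SucI[OF assms(2)])
    show "((\<lambda>x. h (f x)) has_derivative (\<lambda>v. h (frechet_derivative f (at x) v))) (at x)"
      if "x \<in> S" for x
      using bounded_linear.has_derivative[OF assms(1) C_k_on_has_derivative[OF Suc.prems that]] .
    show "C_k_on k (\<lambda>x. h (frechet_derivative f (at x) v)) S" for v
      using Suc by auto
  qed
qed

lemma C_k_on_add:
  assumes "open S" "C_k_on k f S" "C_k_on k g S"
  shows "C_k_on k (\<lambda>x. f x + g x) S"
  using assms(2,3)
proof (induction k arbitrary: f g)
  case 0
  then show ?case
    by (auto intro: continuous_on_add)
next
  case (Suc k)
  show ?case
  proof (rule C_k_on_SucI[OF assms(1)])
    show "((\<lambda>x. f x + g x) has_derivative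
        (\<lambda>v. frechet_derivative f (at x) v + frechet_derivative g (at x) v)) (at x)"
      if "x \<in> S" for x
      using has_derivative_add C_k_on_has_derivative Suc.prems that by blast
    show "C_k_on k (\<lambda>x. frechet_derivative f (at x) v + frechet_derivative g (at x) v) S" for v
      using Suc by auto
  qed
qed

text \<open>Both Leibniz terms are again products under the same bilinear map. Each pairs a
  derivative of class C^k with a factor that \<open>C_k_on_SucD\<close> lowers from C^(k+1) to C^k,
  so the induction hypothesis covers them.\<close>

lemma (in bounded_bilinear) C_k_on:
  assumes "open S" "C_k_on k f S" "C_k_on k g S"
  shows "C_k_on k (\<lambda>x. prod (f x) (g x)) S"
  using assms(2,3)
proof (induction k arbitrary: f g)
  case 0
  then show ?case
    by (auto intro: continuous_on)
next
  case (Suc k)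
  show ?case
  proof (rule C_k_on_SucI[OF assms(1)])
    show "((\<lambda>x. prod (f x) (g x)) has_derivative
        (\<lambda>v. prod (f x) (frechet_derivative g (at x) v) + prod (frechet_derivative f (at x) v) (g x)))
        (at x)" if "x \<in> S" for x
      using FDERIV[OF C_k_on_has_derivative C_k_on_has_derivative] Suc.prems that by blast
    show "C_k_on k (\<lambda>x. prod (f x) (frechet_derivative g (at x) v) +
        prod (frechet_derivative f (at x) v) (g x)) S" for v
      by (rule C_k_on_add[OF assms(1) Suc.IH Suc.IH])
         (use Suc.prems C_k_on_SucD[OF Suc.prems(1)] C_k_on_SucD[OF Suc.prems(2)] in auto)
  qed
qed

lemma C_k_on_powr:
  fixes f :: "'e::real_normed_vector \<Rightarrow> real"
  assumes "open S" "C_k_on k f S" "\<And>x. x \<in> S \<Longrightarrow> f x > 0"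
  shows "C_k_on k (\<lambda>x. f x powr a) S"
  using assms(2)
\<comment> \<open>The derivative contains the exponent \<open>a - 1\<close>, so the induction has to
  cover all exponents at once.\<close>
proof (induction k arbitrary: a)
  case 0
  then show ?case
    using assms(3) by (fastforce intro!: continuous_on_powr continuous_on_const)
next
  case (Suc k)
  show ?case
  proof (rule C_k_on_SucI[OF assms(1)])
    show "((\<lambda>x. f x powr a) has_derivative
        (\<lambda>v. (a * f x powr (a - 1)) * frechet_derivative f (at x) v)) (at x)" if "x \<in> S" for x
    proof -
      have "((\<lambda>y. y powr a) has_derivative (*) (a * f x powr (a - 1))) (at (f x))"
        using has_real_derivative_powr[OF assms(3)[OF that]]
        by (simp add: has_field_derivative_def)
      from has_derivative_compose[OF C_k_on_has_derivative[OF Suc.prems that] this]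
      show ?thesis .
    qed
    show "C_k_on k (\<lambda>x. (a * f x powr (a - 1)) * frechet_derivative f (at x) v) S" for v
      by (intro bounded_bilinear.C_k_on[OF bounded_bilinear_mult] assms(1) C_k_on_const
          Suc.IH C_k_on_SucD[OF Suc.prems]) (use Suc.prems in auto)
  qed
qed

section \<open>Closure properties of infinitely differentiable functions\<close>

lemma smooth_on_cong:
  assumes "open S" "smooth_on f S" "\<And>x. x \<in> S \<Longrightarrow> g x = f x"
  shows "smooth_on g S"
  using assms unfolding smooth_on_def by (metis C_k_on_cong)

lemma smooth_on_const: "open S \<Longrightarrow> smooth_on (\<lambda>x. c) S"
  by (simp add: smooth_on_def C_k_on_const)

lemma smooth_on_bounded_linear:
  "bounded_linear h \<Longrightarrow> open S \<Longrightarrow> smooth_on f S \<Longrightarrow> smooth_on (\<lambda>x. h (f x)) S"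
  by (simp add: smooth_on_def C_k_on_bounded_linear)

lemma smooth_on_add:
  "open S \<Longrightarrow> smooth_on f S \<Longrightarrow> smooth_on g S \<Longrightarrow> smooth_on (\<lambda>x. f x + g x) S"
  by (simp add: smooth_on_def C_k_on_add)

lemma smooth_on_mult:
  fixes f g :: "'e::real_normed_vector \<Rightarrow> real"
  shows "open S \<Longrightarrow> smooth_on f S \<Longrightarrow> smooth_on g S \<Longrightarrow> smooth_on (\<lambda>x. f x * g x) S"
  by (simp add: smooth_on_def bounded_bilinear.C_k_on[OF bounded_bilinear_mult])

lemma smooth_on_scaleR:
  "open S \<Longrightarrow> smooth_on f S \<Longrightarrow> smooth_on g S \<Longrightarrow> smooth_on (\<lambda>x. f x *\<^sub>R g x) S"
  by (simp add: smooth_on_def bounded_bilinear.C_k_on[OF bounded_bilinear_scaleR])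

lemma smooth_on_powr:
  fixes f :: "'e::real_normed_vector \<Rightarrow> real"
  shows "open S \<Longrightarrow> smooth_on f S \<Longrightarrow> (\<And>x. x \<in> S \<Longrightarrow> f x > 0) \<Longrightarrow>
    smooth_on (\<lambda>x. f x powr a) S"
  by (simp add: smooth_on_def C_k_on_powr)

lemma smooth_on_minus: "open S \<Longrightarrow> smooth_on f S \<Longrightarrow> smooth_on (\<lambda>x. - f x) S"
  by (rule smooth_on_bounded_linear[OF bounded_linear_minus[OF bounded_linear_ident]])

lemma smooth_on_diff:
  "open S \<Longrightarrow> smooth_on f S \<Longrightarrow> smooth_on g S \<Longrightarrow> smooth_on (\<lambda>x. f x - g x) S"
  using smooth_on_add[OF _ _ smooth_on_minus] by fastforce

lemma smooth_on_sum:
  assumes "open S" "\<And>i. i \<in> I \<Longrightarrow> smooth_on (f i) S"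
  shows "smooth_on (\<lambda>x. \<Sum>i\<in>I. f i x) S"
  using assms(2)
  by (induction I rule: infinite_finite_induct)
     (auto intro!: smooth_on_const smooth_on_add assms(1))

lemma smooth_on_Pair:
  assumes "open S" "smooth_on f S" "smooth_on g S"
  shows "smooth_on (\<lambda>x. (f x, g x)) S"
proof -
  have "smooth_on (\<lambda>x. (f x, 0) + (0, g x)) S"
    by (intro smooth_on_add assms smooth_on_bounded_linear[of "\<lambda>y. (y, 0)"]
        smooth_on_bounded_linear[of "\<lambda>y. (0, y)"])
       (auto intro!: bounded_linear_intros)
  then show ?thesis by simp
qed

lemma smooth_on_inverse:
  fixes f :: "'e::real_normed_vector \<Rightarrow> real"
  assumes "open S" "smooth_on f S" "\<And>x. x \<in> S \<Longrightarrow> f x \<noteq> 0"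
  shows "smooth_on (\<lambda>x. inverse (f x)) S"
proof -
  \<comment> \<open>\<open>smooth_on_powr\<close> asks for a positive base, while f may be negative
    on parts of S; writing 1/f = f * (f^2)^(-1) removes the sign.\<close>
  have "smooth_on (\<lambda>x. f x * (f x * f x) powr -1) S"
    by (intro smooth_on_mult smooth_on_powr assms) (use assms(3) in \<open>auto simp: zero_less_mult_iff linorder_neq_iff\<close>)
  then show ?thesis
    by (rule smooth_on_cong[OF assms(1)]) (use assms(3) in \<open>auto simp: powr_minus field_simps\<close>)
qed


section \<open>Symmetry of second derivatives\<close>

text \<open>The second difference is the increment over [0, t] of s |-> f(x + su + tv) - f(x + su).
  The mean value theorem turns it into t times a difference of two values of y |->
  \<open>f' y u\<close>, and P linearises that difference at x.\<close>

lemma second_difference_quotient_tendsto: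
  fixes f :: "'e::real_normed_vector \<Rightarrow> real"
  assumes S: "open S" "x \<in> S" and f: "\<And>y. y \<in> S \<Longrightarrow> (f has_derivative f' y) (at y)"
    and P: "((\<lambda>y. f' y u) has_derivative P) (at x)"
  shows "((\<lambda>t. (f (x + t *\<^sub>R u + t *\<^sub>R v) - f (x + t *\<^sub>R u) - f (x + t *\<^sub>R v) + f x) / t\<^sup>2) \<longlongrightarrow> P v)
    (at_right 0)"
proof (rule tendstoI)
  fix e :: real
  assume e: "e > 0"
  \<comment> \<open>The summand 1 keeps N positive for u = v = 0. Since N exceeds
    \<open>norm u + norm v\<close>, an error rate of order e / N stays below e after multiplication
    by the displacements.\<close>
  define N where "N = 2 * (norm u + norm v) + 1"
  have N: "N > 0"
    unfolding N_def by (intro add_nonneg_pos mult_nonneg_nonneg add_nonneg_nonneg norm_ge_zero) simp_all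
  have lin: "bounded_linear P"
    using P by (rule has_derivative_bounded_linear)
  obtain r where r: "r > 0" "ball x r \<subseteq> S"
    using S open_contains_ball by blast
  obtain d where d: "d > 0" "\<And>y. norm (y - x) < d \<Longrightarrow>
      norm (f' y u - f' x u - P (y - x)) \<le> e / (2 * N) * norm (y - x)"
    using P e N unfolding has_derivative_at_alt by (metis divide_pos_pos mult_pos_pos zero_less_numeral)
  \<comment> \<open>For t < m the whole parallelogram spanned by tu and tv at x lies in S and in the
    region where the linearisation by P is controlled.\<close>
  define m where "m = min r d / N"
  have m: "m > 0"
    using r d N by (simp add: m_def)
  have "dist ((f (x + t *\<^sub>R u + t *\<^sub>R v) - f (x + t *\<^sub>R u) - f (x + t *\<^sub>R v) + f x) / t\<^sup>2) (P v) < e"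
    if t: "0 < t" "t < m" for t
  proof -
    have near: "norm (a *\<^sub>R u + b *\<^sub>R v) < min r d \<and> norm (a *\<^sub>R u + b *\<^sub>R v) \<le> t * (norm u + norm v)"
      if "0 \<le> a" "a \<le> t" "0 \<le> b" "b \<le> t" for a b
    proof -
      have "norm (a *\<^sub>R u + b *\<^sub>R v) \<le> a * norm u + b * norm v"
        using norm_triangle_ineq[of "a *\<^sub>R u" "b *\<^sub>R v"] that by simp
      also have "\<dots> \<le> t * (norm u + norm v)"
        using that by (simp add: distrib_left add_mono mult_right_mono)
      finally have le: "norm (a *\<^sub>R u + b *\<^sub>R v) \<le> t * (norm u + norm v)" .
      also have "\<dots> \<le> t * N"
        using t norm_ge_zero[of u] norm_ge_zero[of v] by (intro mult_left_mono) (auto simp: N_def)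
      also have "\<dots> < min r d"
        using t N by (simp add: m_def pos_less_divide_eq)
      finally show ?thesis using le by simp
    qed
    have inS: "x + a *\<^sub>R u + b *\<^sub>R v \<in> S" if "0 \<le> a" "a \<le> t" "0 \<le> b" "b \<le> t" for a b
    proof -
      have "dist x (x + w) = norm w" for w
        by (simp add: dist_norm)
      then have "x + (a *\<^sub>R u + b *\<^sub>R v) \<in> ball x r"
        using near[OF that] by simp
      then show ?thesis
        using r(2) by (auto simp: add.assoc)
    qed
    have der: "((\<lambda>s. f (x + s *\<^sub>R u + b *\<^sub>R v)) has_real_derivative f' (x + s *\<^sub>R u + b *\<^sub>R v) u) (at s)"
      if "0 \<le> s" "s \<le> t" "0 \<le> b" "b \<le> t" for s b
    proof -
      have "((\<lambda>s. x + s *\<^sub>R u + b *\<^sub>R v) has_derivative (\<lambda>h. h *\<^sub>R u)) (at s)"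
        by (auto intro!: derivative_eq_intros)
      from has_derivative_compose[OF this f[OF inS[OF that]]]
      have "((\<lambda>s. f (x + s *\<^sub>R u + b *\<^sub>R v)) has_derivative (\<lambda>h. f' (x + s *\<^sub>R u + b *\<^sub>R v) (h *\<^sub>R u))) (at s)" .
      then show ?thesis
        using linear_scale[OF has_derivative_linear[OF f[OF inS[OF that]]]]
        by (simp add: has_field_derivative_def mult.commute[of _ "f' _ u"])
    qed
    have der2: "((\<lambda>s. f (x + s *\<^sub>R u + t *\<^sub>R v) - f (x + s *\<^sub>R u + 0 *\<^sub>R v)) has_real_derivative
        f' (x + s *\<^sub>R u + t *\<^sub>R v) u - f' (x + s *\<^sub>R u + 0 *\<^sub>R v) u) (at s)"
      if "0 \<le> s" "s \<le> t" for s
      by (intro DERIV_diff der) (use that t in auto)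
    obtain s where s: "0 < s" "s < t" and
      mvt: "(f (x + t *\<^sub>R u + t *\<^sub>R v) - f (x + t *\<^sub>R u + 0 *\<^sub>R v)) -
            (f (x + 0 *\<^sub>R u + t *\<^sub>R v) - f (x + 0 *\<^sub>R u + 0 *\<^sub>R v)) =
            (t - 0) * (f' (x + s *\<^sub>R u + t *\<^sub>R v) u - f' (x + s *\<^sub>R u + 0 *\<^sub>R v) u)"
      using MVT2[OF t(1) der2] by blast
    \<comment> \<open>\<open>q b\<close> is the remainder of the first-order expansion of y |->
      \<open>f' y u\<close> at x. Only \<open>(q t - q 0) / t\<close> separates the quotient from
      \<open>P v\<close>.\<close>
    define q where "q = (\<lambda>b. f' (x + s *\<^sub>R u + b *\<^sub>R v) u - f' x u - P (s *\<^sub>R u + b *\<^sub>R v))"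
    have q: "\<bar>q b\<bar> \<le> e / (2 * N) * (t * (norm u + norm v))" if "0 \<le> b" "b \<le> t" for b
    proof -
      have "\<bar>q b\<bar> \<le> e / (2 * N) * norm (s *\<^sub>R u + b *\<^sub>R v)"
        using d(2)[of "x + s *\<^sub>R u + b *\<^sub>R v"] near[of s b] s that by (simp add: q_def add.assoc)
      also have "\<dots> \<le> e / (2 * N) * (t * (norm u + norm v))"
        using near[of s b] s that e N by (intro mult_left_mono) auto
      finally show ?thesis .
    qed
    have "P (s *\<^sub>R u + t *\<^sub>R v) - P (s *\<^sub>R u + 0 *\<^sub>R v) = t * P v"
      using bounded_linear.linear[OF lin] by (simp add: linear_add linear_scale)
    then have "f' (x + s *\<^sub>R u + t *\<^sub>R v) u - f' (x + s *\<^sub>R u + 0 *\<^sub>R v) u = t * P v + (q t - q 0)"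
      unfolding q_def by linarith
    from mvt[unfolded this]
    have "f (x + t *\<^sub>R u + t *\<^sub>R v) - f (x + t *\<^sub>R u) - f (x + t *\<^sub>R v) + f x =
        t * (t * P v + (q t - q 0))"
      by simp
    then have "(f (x + t *\<^sub>R u + t *\<^sub>R v) - f (x + t *\<^sub>R u) - f (x + t *\<^sub>R v) + f x) / t\<^sup>2 - P v
        = (t * (t * P v + (q t - q 0))) / t\<^sup>2 - P v"
      by (simp only:)
    also have "\<dots> = (q t - q 0) / t"
      using t by (simp add: power2_eq_square add_divide_distrib)
    finally have "\<bar>(f (x + t *\<^sub>R u + t *\<^sub>R v) - f (x + t *\<^sub>R u) - f (x + t *\<^sub>R v) + f x) / t\<^sup>2 - P v\<bar>
        = \<bar>(q t - q 0) / t\<bar>"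
      by (simp only:)
    also have "\<dots> \<le> 2 * (e / (2 * N) * (t * (norm u + norm v))) / t"
    proof -
      have "\<bar>q t - q 0\<bar> \<le> 2 * (e / (2 * N) * (t * (norm u + norm v)))"
        using q[of t] q[of 0] t by linarith
      then show ?thesis
        using t by (simp only: abs_divide divide_right_mono abs_of_pos less_imp_le)
    qed
    also have "\<dots> = e * ((norm u + norm v) / N)"
    proof -
      have "2 * (e / (2 * N) * (t * K)) / t = e * (K / N)" for K
        using t N by (simp add: field_simps)
      then show ?thesis .
    qed
    also have "\<dots> < e * 1"
      using e N by (intro mult_strict_left_mono) (simp_all only: pos_divide_less_eq, simp add: N_def add_nonneg_pos)
    finally show ?thesis
      by (simp add: dist_norm)
  qed
  then show "\<forall>\<^sub>F t in at_right 0. dist ((f (x + t *\<^sub>R u + t *\<^sub>R v) - f (x + t *\<^sub>R u)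
      - f (x + t *\<^sub>R v) + f x) / t\<^sup>2) (P v) < e"
    using m eventually_at_right_field by blast
qed

text \<open>The second difference is unchanged when u and v are exchanged, so both mixed derivatives
  are limits of the same quotient.\<close>

lemma second_derivative_symmetric:
  fixes f :: "'e::real_normed_vector \<Rightarrow> real"
  assumes "open S" "x \<in> S" and "\<And>y. y \<in> S \<Longrightarrow> (f has_derivative f' y) (at y)"
    and "((\<lambda>y. f' y u) has_derivative P) (at x)" "((\<lambda>y. f' y v) has_derivative Q) (at x)"
  shows "P v = Q u"
proof -
  have "((\<lambda>t. (f (x + t *\<^sub>R u + t *\<^sub>R v) - f (x + t *\<^sub>R u) - f (x + t *\<^sub>R v) + f x) / t\<^sup>2) \<longlongrightarrow> Q u)
    (at_right 0)"
    using second_difference_quotient_tendsto[OF assms(1-3,5), of u]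
    by (simp add: algebra_simps)
  with second_difference_quotient_tendsto[OF assms(1-4), of v] show ?thesis
    using tendsto_unique[OF trivial_limit_at_right_real] by blast
qed

section \<open>Tangent and cotangent spaces in a chart\<close>

lemma scaleR_fun_apply: "(r *\<^sub>R f) x = r *\<^sub>R f x"
  by (simp add: scaleR_fun_def)

lemma linear_euclidean_sum:
  fixes f :: "'a::euclidean_space \<Rightarrow> 'b::real_vector"
  assumes "linear f"
  shows "f x = (\<Sum>b\<in>Basis. (x \<bullet> b) *\<^sub>R f b)"
proof -
  have "f x = f (\<Sum>b\<in>Basis. (x \<bullet> b) *\<^sub>R b)"
    by (simp only: euclidean_representation)
  then show ?thesis
    using assms by (simp add: linear_sum linear_scale)
qed

text \<open>Charts identify tangent spaces through first derivatives of transitions, so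
  differentiability is all that is asked of them. This keeps the cotangent atlas within easy reach:
  one derivative computation makes it an instance, next to the base atlas.\<close>

locale differentiable_atlas =
  fixes M :: "('p, 'e::euclidean_space) chart set"
  assumes chart_inj: "c \<in> M \<Longrightarrow> inj_on (snd c) (fst c)"
    and open_overlap: "c \<in> M \<Longrightarrow> d \<in> M \<Longrightarrow> open (snd c ` (fst c \<inter> fst d))"
    and transition_differentiable: "c \<in> M \<Longrightarrow> d \<in> M \<Longrightarrow> z \<in> fst c \<Longrightarrow> z \<in> fst d \<Longrightarrow>
      transition c d differentiable (at (snd c z))"
begin

lemma open_chart_range: "c \<in> M \<Longrightarrow> open (chart_range c)"
  using open_overlap[of c c] by (simp add: chart_range_def)

lemma chart_inv_chart [simp]: "c \<in> M \<Longrightarrow> z \<in> fst c \<Longrightarrow> chart_inv c (snd c z) = z"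
  by (simp add: chart_inv_def chart_inj)

lemma chart_inv_range:
  "x \<in> chart_range c \<Longrightarrow> chart_inv c x \<in> fst c \<and> snd c (chart_inv c x) = x"
  by (auto simp: chart_inv_def chart_range_def inv_into_into f_inv_into_f)

lemma transition_chart [simp]: "c \<in> M \<Longrightarrow> z \<in> fst c \<Longrightarrow> transition c d (snd c z) = snd d z"
  by (simp add: transition_def)

lemma transition_has_derivative:
  "c \<in> M \<Longrightarrow> d \<in> M \<Longrightarrow> z \<in> fst c \<Longrightarrow> z \<in> fst d \<Longrightarrow>
    (transition c d has_derivative frechet_derivative (transition c d) (at (snd c z))) (at (snd c z))"
  using transition_differentiable frechet_derivative_works by blast

lemma linear_transition_derivative:
  "c \<in> M \<Longrightarrow> d \<in> M \<Longrightarrow> z \<in> fst c \<Longrightarrow> z \<in> fst d \<Longrightarrow>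
    linear (frechet_derivative (transition c d) (at (snd c z)))"
  by (rule has_derivative_linear[OF transition_has_derivative])

lemma transition_derivative_compose:
  assumes "a \<in> M" "b \<in> M" "c \<in> M" "z \<in> fst a" "z \<in> fst b" "z \<in> fst c"
  shows "frechet_derivative (transition b c) (at (snd b z))
      (frechet_derivative (transition a b) (at (snd a z)) e)
    = frechet_derivative (transition a c) (at (snd a z)) e"
proof -
  have "((\<lambda>x. transition b c (transition a b x)) has_derivative
      (\<lambda>e. frechet_derivative (transition b c) (at (snd b z))
        (frechet_derivative (transition a b) (at (snd a z)) e))) (at (snd a z))"
    using has_derivative_compose[OF transition_has_derivative[of a b z], of "transition b c"]
      transition_has_derivative[of b c z] assms by simp
  then have "(transition a c has_derivative
      (\<lambda>e. frechet_derivative (transition b c) (at (snd b z))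
        (frechet_derivative (transition a b) (at (snd a z)) e))) (at (snd a z))"
    \<comment> \<open>\<open>snd c\<close> is a total function, so the two maps agree on the whole
      overlap of \<open>a\<close> and \<open>b\<close>, which is open.\<close>
    by (rule has_derivative_transform_within_open[OF _ open_overlap[OF assms(1,2)]])
       (use assms in auto)
  from has_derivative_unique[OF this transition_has_derivative] assms show ?thesis
    by metis
qed

lemma transition_derivative_self:
  assumes "c \<in> M" "z \<in> fst c"
  shows "frechet_derivative (transition c c) (at (snd c z)) e = e"
proof -
  have "(transition c c has_derivative (\<lambda>e. e)) (at (snd c z))"
    by (rule has_derivative_transform_within_open[OF has_derivative_ident open_chart_range])
       (use assms in \<open>auto simp: chart_range_def\<close>)
  from has_derivative_unique[OF this transition_has_derivative] assms show ?thesis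
    by metis
qed

lemma tangent_vec_transition:
  "X \<in> tangent_space M z \<Longrightarrow> c \<in> M \<Longrightarrow> d \<in> M \<Longrightarrow> z \<in> fst c \<Longrightarrow> z \<in> fst d \<Longrightarrow>
    X d = frechet_derivative (transition c d) (at (snd c z)) (X c)"
  unfolding tangent_space_def mem_Collect_eq by blast

lemma tangent_vec_off: "X \<in> tangent_space M z \<Longrightarrow> \<not> (c \<in> M \<and> z \<in> fst c) \<Longrightarrow> X c = 0"
  unfolding tangent_space_def mem_Collect_eq by blast

lemma tangent_spaceI:
  assumes "\<And>c d. c \<in> M \<Longrightarrow> d \<in> M \<Longrightarrow> z \<in> fst c \<Longrightarrow> z \<in> fst d \<Longrightarrow>
      X d = frechet_derivative (transition c d) (at (snd c z)) (X c)"
    and "\<And>c. \<not> (c \<in> M \<and> z \<in> fst c) \<Longrightarrow> X c = 0"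
  shows "X \<in> tangent_space M z"
  using assms unfolding tangent_space_def mem_Collect_eq by blast

lemma tangent_space_add:
  assumes "X \<in> tangent_space M z" "Y \<in> tangent_space M z"
  shows "X + Y \<in> tangent_space M z"
proof (rule tangent_spaceI)
  fix c d
  assume "c \<in> M" "d \<in> M" "z \<in> fst c" "z \<in> fst d"
  then show "(X + Y) d = frechet_derivative (transition c d) (at (snd c z)) ((X + Y) c)"
    using assms by (simp add: linear_add[OF linear_transition_derivative] tangent_vec_transition[of _ z c d])
qed (simp add: tangent_vec_off[OF assms(1)] tangent_vec_off[OF assms(2)])

lemma tangent_space_scaleR:
  assumes "X \<in> tangent_space M z"
  shows "r *\<^sub>R X \<in> tangent_space M z"
proof (rule tangent_spaceI)
  fix c d
  assume "c \<in> M" "d \<in> M" "z \<in> fst c" "z \<in> fst d"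
  then show "(r *\<^sub>R X) d = frechet_derivative (transition c d) (at (snd c z)) ((r *\<^sub>R X) c)"
    using assms by (simp add: scaleR_fun_apply linear_scale[OF linear_transition_derivative]
        tangent_vec_transition[of _ z c d])
qed (simp add: scaleR_fun_apply tangent_vec_off[OF assms])

lemma coord_vec_tangent:
  assumes "c \<in> M" "z \<in> fst c"
  shows "coord_vec M c z e \<in> tangent_space M z"
proof (rule tangent_spaceI)
  show "coord_vec M c z e a = 0" if "\<not> (a \<in> M \<and> z \<in> fst a)" for a
    using that by (metis coord_vec_def)
qed (simp add: assms coord_vec_def transition_derivative_compose[of c])

lemma coord_vec_self [simp]: "c \<in> M \<Longrightarrow> z \<in> fst c \<Longrightarrow> coord_vec M c z e c = e"
  by (simp add: coord_vec_def transition_derivative_self)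

lemma coord_vec_tangent_vec:
  assumes "c \<in> M" "z \<in> fst c" "X \<in> tangent_space M z"
  shows "coord_vec M c z (X c) = X"
proof
  show "coord_vec M c z (X c) d = X d" for d
    using tangent_vec_transition[OF assms(3,1) _ assms(2)] tangent_vec_off[OF assms(3)]
    by (simp add: coord_vec_def)
qed

lemma tangent_vec_eqI:
  "c \<in> M \<Longrightarrow> z \<in> fst c \<Longrightarrow> X \<in> tangent_space M z \<Longrightarrow> Y \<in> tangent_space M z \<Longrightarrow> X c = Y c \<Longrightarrow> X = Y"
  by (metis coord_vec_tangent_vec)

lemma linear_coord_vec:
  assumes "c \<in> M" "z \<in> fst c"
  shows "linear (coord_vec M c z)"
proof (rule linearI)
  show "coord_vec M c z (x + y) = coord_vec M c z x + coord_vec M c z y" for x y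
    by (rule tangent_vec_eqI[OF assms]) (simp_all add: assms coord_vec_tangent tangent_space_add)
  show "coord_vec M c z (r *\<^sub>R x) = r *\<^sub>R coord_vec M c z x" for r x
    by (rule tangent_vec_eqI[OF assms])
       (simp_all add: assms coord_vec_tangent tangent_space_scaleR scaleR_fun_apply)
qed

lemma linear_on_coord_vec:
  assumes "linear_on (tangent_space M z) \<xi>" "c \<in> M" "z \<in> fst c"
  shows "linear (\<lambda>e. \<xi> (coord_vec M c z e))"
  using assms(1) coord_vec_tangent[OF assms(2,3)] linear_coord_vec[OF assms(2,3)]
  by (intro linearI) (simp_all add: linear_on_def linear_add linear_scale)

lemma linear_on_eq_inner:
  assumes "linear_on (tangent_space M z) \<xi>" "c \<in> M" "z \<in> fst c" "X \<in> tangent_space M z"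
  shows "\<xi> X = (\<Sum>b\<in>Basis. \<xi> (coord_vec M c z b) *\<^sub>R b) \<bullet> X c"
  using linear_euclidean_sum[OF linear_on_coord_vec[OF assms(1-3)], of "X c"] assms
  by (simp add: coord_vec_tangent_vec inner_sum_left inner_commute[of _ "X c"] inner_sum_right mult.commute)

lemma inner_cotangent:
  assumes "c \<in> M" "z \<in> fst c"
  shows "(\<lambda>Y. if Y \<in> tangent_space M z then w \<bullet> Y c else 0) \<in> cotangent_space M z"
  by (simp add: cotangent_space_def linear_on_def tangent_space_add tangent_space_scaleR
      scaleR_fun_apply inner_add_right)

lemma cotangent_eqI:
  assumes "\<xi> \<in> cotangent_space M z" "\<zeta> \<in> cotangent_space M z"
    and "\<And>X. X \<in> tangent_space M z \<Longrightarrow> \<xi> X = \<zeta> X"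
  shows "\<xi> = \<zeta>"
proof
  show "\<xi> X = \<zeta> X" for X
    using assms by (cases "X \<in> tangent_space M z") (auto simp: cotangent_space_def)
qed

end

section \<open>The cotangent atlas\<close>

definition std_symplectic :: "'e::real_inner \<times> 'e \<Rightarrow> 'e \<times> 'e \<Rightarrow> real"
  where "std_symplectic X Y = fst X \<bullet> snd Y - snd X \<bullet> fst Y"

locale smooth_base =
  fixes B :: "('p, 'e::euclidean_space) chart set"
  assumes smooth: "smooth_atlas B"
begin

lemma transition_smooth:
  "c \<in> B \<Longrightarrow> d \<in> B \<Longrightarrow> C_k_on k (transition c d) (snd c ` (fst c \<inter> fst d))"
  using smooth unfolding smooth_atlas_def smooth_on_def by blast

sublocale base: differentiable_atlas B
proof
  show "inj_on (snd c) (fst c)" if "c \<in> B" for c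
    using smooth that unfolding smooth_atlas_def by blast
  show "open (snd c ` (fst c \<inter> fst d))" if "c \<in> B" "d \<in> B" for c d
    using smooth that unfolding smooth_atlas_def by blast
  show "transition c d differentiable at (snd c z)"
    if "c \<in> B" "d \<in> B" "z \<in> fst c" "z \<in> fst d" for c d z
    using transition_smooth[OF that(1,2), of "Suc 0"] that(3,4) by simp
qed

text \<open>The covector with momentum components p in the chart c; as a function of (q, p) it
  inverts the induced cotangent chart.\<close>

definition covector :: "('p, 'e) chart \<Rightarrow> 'p \<Rightarrow> 'e \<Rightarrow> ('p, 'e) covec"
  where "covector c q p = (\<lambda>Y. if Y \<in> tangent_space B q then p \<bullet> Y c else 0)"

lemma mem_cotangent_chart:
  "z \<in> fst (cotangent_chart B c) \<longleftrightarrow> fst z \<in> fst c \<and> snd z \<in> cotangent_space B (fst z)"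
  by (cases z) (simp add: cotangent_chart_def)

lemma cotangent_chart_apply:
  "snd (cotangent_chart B c) z = (snd c (fst z), \<Sum>b\<in>Basis. snd z (coord_vec B c (fst z) b) *\<^sub>R b)"
  by (cases z) (simp add: cotangent_chart_def)

lemma covector_mem:
  assumes "c \<in> B" "q \<in> fst c" "q \<in> fst d"
  shows "(q, covector c q p) \<in> fst (cotangent_chart B d)"
  using base.inner_cotangent[OF assms(1,2), of p] assms by (simp add: mem_cotangent_chart covector_def)

text \<open>Momenta transform by the transpose of the derivative of the reverse transition, from d
  to c, because a coordinate vector of d must be rewritten in c before it is paired with p.\<close>

lemma cotangent_chart_covector:
  assumes "c \<in> B" "d \<in> B" "q \<in> fst c" "q \<in> fst d"
  shows "snd (cotangent_chart B d) (q, covector c q p) =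
    (snd d q, \<Sum>b\<in>Basis. (p \<bullet> frechet_derivative (transition d c) (at (snd d q)) b) *\<^sub>R b)"
  using assms by (simp add: cotangent_chart_apply covector_def base.coord_vec_tangent)
                 (simp add: coord_vec_def)

lemma cotangent_chart_covector_self:
  assumes "c \<in> B" "q \<in> fst c"
  shows "snd (cotangent_chart B c) (q, covector c q p) = (snd c q, p)"
  using cotangent_chart_covector[OF assms(1,1,2,2)] assms
  by (simp add: base.transition_derivative_self euclidean_representation)

lemma eq_covector:
  assumes "c \<in> B" "z \<in> fst (cotangent_chart B c)"
  shows "z = (fst z, covector c (fst z) (snd (snd (cotangent_chart B c) z)))"
proof -
  have z: "fst z \<in> fst c" "snd z \<in> cotangent_space B (fst z)"
    using assms by (auto simp: mem_cotangent_chart)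
  have "snd z = covector c (fst z) (snd (snd (cotangent_chart B c) z))"
  proof (rule base.cotangent_eqI[OF z(2)])
    show "covector c (fst z) (snd (snd (cotangent_chart B c) z)) \<in> cotangent_space B (fst z)"
      using base.inner_cotangent[OF assms(1) z(1)] by (simp add: covector_def)
    show "snd z X = covector c (fst z) (snd (snd (cotangent_chart B c) z)) X"
      if "X \<in> tangent_space B (fst z)" for X
      using base.linear_on_eq_inner[OF _ assms(1) z(1) that, of "snd z"] z(2) that
      by (simp add: covector_def cotangent_chart_apply cotangent_space_def)
  qed
  then show ?thesis
    by (metis prod.collapse)
qed

lemma cotangent_chart_inj:
  assumes "c \<in> B"
  shows "inj_on (snd (cotangent_chart B c)) (fst (cotangent_chart B c))"
proof (rule inj_onI)
  fix z w
  assume z: "z \<in> fst (cotangent_chart B c)" and w: "w \<in> fst (cotangent_chart B c)"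
    and eq: "snd (cotangent_chart B c) z = snd (cotangent_chart B c) w"
  have "snd c (fst z) = snd c (fst w)"
    using eq by (simp add: cotangent_chart_apply)
  then have "fst z = fst w"
    using z w base.chart_inj[OF assms] by (auto simp: mem_cotangent_chart dest: inj_onD)
  then show "z = w"
    using eq_covector[OF assms z] eq_covector[OF assms w] eq by metis
qed

lemma cotangent_chart_overlap:
  assumes "c \<in> B" "d \<in> B"
  shows "snd (cotangent_chart B c) ` (fst (cotangent_chart B c) \<inter> fst (cotangent_chart B d)) =
    (snd c ` (fst c \<inter> fst d)) \<times> UNIV" (is "?L = ?R")
proof
  show "?L \<subseteq> ?R"
    by (auto simp: mem_cotangent_chart cotangent_chart_apply)
  show "?R \<subseteq> ?L"
  proof
    fix y
    assume "y \<in> ?R"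
    then obtain q where q: "q \<in> fst c" "q \<in> fst d" "fst y = snd c q"
      by auto
    then have "y = snd (cotangent_chart B c) (q, covector c q (snd y))"
      by (simp add: cotangent_chart_covector_self[OF assms(1)] prod_eq_iff)
    then show "y \<in> ?L"
      using covector_mem[OF assms(1) q(1)] q by blast
  qed
qed

lemma cotangent_transition:
  assumes "c \<in> B" "d \<in> B" "x \<in> snd c ` (fst c \<inter> fst d)"
  shows "transition (cotangent_chart B c) (cotangent_chart B d) (x, p) = (transition c d x,
    \<Sum>b\<in>Basis. (p \<bullet> frechet_derivative (transition d c) (at (transition c d x)) b) *\<^sub>R b)"
proof -
  obtain q where q: "q \<in> fst c" "q \<in> fst d" "x = snd c q"
    using assms(3) by blast
  have "chart_inv (cotangent_chart B c) (x, p) = (q, covector c q p)"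
    using inv_into_f_f[OF cotangent_chart_inj[OF assms(1)] covector_mem[OF assms(1) q(1,1)]]
    by (simp add: chart_inv_def cotangent_chart_covector_self[OF assms(1) q(1)] q(3))
  then show ?thesis
    using assms q by (simp add: transition_def[of "cotangent_chart B c"] cotangent_chart_covector)
qed

text \<open>The second derivative of the base transition enters through the \<open>p\<close>-component; its symmetry
  is what makes the transition symplectic.\<close>

lemma cotangent_transition_derivative:
  assumes "c \<in> B" "d \<in> B" "z \<in> fst (cotangent_chart B c)" "z \<in> fst (cotangent_chart B d)"
  obtains F where "(transition (cotangent_chart B c) (cotangent_chart B d) has_derivative F)
      (at (snd (cotangent_chart B c) z))"
    and "\<And>U V. std_symplectic (F U) (F V) = std_symplectic U V"
proof -
  define q where "q = fst z"
  define p where "p = snd (snd (cotangent_chart B c) z)"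
  have q: "q \<in> fst c" "q \<in> fst d"
    using assms by (auto simp: q_def mem_cotangent_chart)
  define \<phi> where "\<phi> = transition c d"
  define \<psi> where "\<psi> = transition d c"
  define \<phi>' where "\<phi>' = frechet_derivative \<phi> (at (snd c q))"
  define \<psi>' where "\<psi>' = (\<lambda>y. frechet_derivative \<psi> (at y))"
  \<comment> \<open>\<open>H e k\<close> is the second derivative of \<psi> at
    \<open>snd d q\<close> in the directions e and k.\<close>
  define H where "H = (\<lambda>e. frechet_derivative (\<lambda>y. \<psi>' y e) (at (snd d q)))"
  define W where "W = snd d ` (fst d \<inter> fst c)"
  have W: "open W" "snd d q \<in> W"
    using base.open_overlap[OF assms(2,1)] q by (auto simp: W_def)
  have \<phi>': "(\<phi> has_derivative \<phi>') (at (snd c q))"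
    unfolding \<phi>'_def \<phi>_def using base.transition_has_derivative assms q by blast
  have \<psi>': "(\<psi> has_derivative \<psi>' y) (at y)" if "y \<in> W" for y
    using C_k_on_has_derivative[OF transition_smooth[OF assms(2,1), of "Suc 0"]] that
    by (simp add: W_def \<psi>_def \<psi>'_def)
  have H: "((\<lambda>y. \<psi>' y e) has_derivative H e) (at (snd d q))" for e
  proof -
    have "C_k_on (Suc 0) (\<lambda>y. \<psi>' y e) W"
      using transition_smooth[OF assms(2,1), of "Suc (Suc 0)"] unfolding W_def \<psi>_def \<psi>'_def
        C_k_on.simps(2)[of "Suc 0"] by blast
    from C_k_on_has_derivative[OF this W(2)] show ?thesis
      by (simp only: H_def)
  qed
  \<comment> \<open>As a derivative, \<open>H e\<close> is linear in k. Linearity in e comes from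
    the linearity of \<open>\<psi>' y\<close> for y near \<open>snd d q\<close> and uniqueness of
    derivatives.\<close>
  have H_lin: "linear (\<lambda>e. H e k)" for k
  proof (rule linearI)
    fix e f r
    have "((\<lambda>y. \<psi>' y (e + f)) has_derivative (\<lambda>k. H e k + H f k)) (at (snd d q))"
      by (rule has_derivative_transform_within_open[OF has_derivative_add[OF H H] W])
         (simp add: linear_add[OF has_derivative_linear[OF \<psi>']])
    then show "H (e + f) k = H e k + H f k"
      using has_derivative_unique[OF H] by metis
    have "((\<lambda>y. \<psi>' y (r *\<^sub>R e)) has_derivative (\<lambda>k. r *\<^sub>R H e k)) (at (snd d q))"
      by (rule has_derivative_transform_within_open[OF has_derivative_scaleR_right[OF H] W])
         (simp add: linear_scale[OF has_derivative_linear[OF \<psi>']])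
    then show "H (r *\<^sub>R e) k = r *\<^sub>R H e k"
      using has_derivative_unique[OF H] by metis
  qed
  \<comment> \<open>Pairing with p gives the real-valued function y |-> p \<bullet> \<psi> y, to
    which the scalar symmetry result applies.\<close>
  have H_sym: "p \<bullet> H e f = p \<bullet> H f e" for e f
    using second_derivative_symmetric[OF W, of "\<lambda>y. p \<bullet> \<psi> y" "\<lambda>y e. p \<bullet> \<psi>' y e" e
        "\<lambda>k. p \<bullet> H e k" f "\<lambda>k. p \<bullet> H f k"] \<psi>' H
    by (simp add: has_derivative_inner_right)
  have \<psi>\<phi>: "\<psi>' (snd d q) (\<phi>' u) = u" for u
    using base.transition_derivative_compose[OF assms(1,2,1) q(1,2,1)] base.transition_derivative_self
      assms(1) q by (simp add: \<psi>'_def \<phi>'_def \<phi>_def \<psi>_def)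
  \<comment> \<open>The product rule for the lift: a momentum component p \<bullet> \<psi>'(\<phi>
    x) b varies through p itself and, by the chain rule, through the base point x.\<close>
  define F where "F = (\<lambda>U. (\<phi>' (fst U),
    \<Sum>b\<in>Basis. (snd U \<bullet> \<psi>' (snd d q) b + p \<bullet> H b (\<phi>' (fst U))) *\<^sub>R b))"
  show thesis
  proof
    have z: "snd (cotangent_chart B c) z = (snd c q, p)"
      by (simp add: p_def q_def cotangent_chart_apply)
    have x: "((\<lambda>y. \<phi> (fst y)) has_derivative (\<lambda>U. \<phi>' (fst U))) (at (snd c q, p))"
      by (rule has_derivative_compose[OF has_derivative_fst[OF has_derivative_ident]]) (simp add: \<phi>')
    have "((\<lambda>y. \<psi>' (\<phi> (fst y)) b) has_derivative (\<lambda>U. H b (\<phi>' (fst U)))) (at (snd c q, p))" for b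
      using has_derivative_compose[OF x, of "\<lambda>y. \<psi>' y b" "H b"] H[of b] assms(1) q(1)
      by (simp add: \<phi>_def)
    then have "((\<lambda>y. (\<phi> (fst y), \<Sum>b\<in>Basis. (snd y \<bullet> \<psi>' (\<phi> (fst y)) b) *\<^sub>R b)) has_derivative F)
        (at (snd c q, p))"
      unfolding F_def using assms(1) q(1)
      by (auto intro!: derivative_eq_intros x[unfolded \<phi>_def] simp: \<phi>_def add.commute)
    then show "(transition (cotangent_chart B c) (cotangent_chart B d) has_derivative F)
      (at (snd (cotangent_chart B c) z))"
      unfolding z
    proof (rule has_derivative_transform_within_open)
      show "open ((snd c ` (fst c \<inter> fst d)) \<times> (UNIV :: 'e set))"
        using base.open_overlap[OF assms(1,2)] by (rule open_Times) simp
      show "(snd c q, p) \<in> (snd c ` (fst c \<inter> fst d)) \<times> UNIV"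
        using q by auto
      show "(\<phi> (fst y), \<Sum>b\<in>Basis. (snd y \<bullet> \<psi>' (\<phi> (fst y)) b) *\<^sub>R b) =
          transition (cotangent_chart B c) (cotangent_chart B d) y"
        if "y \<in> (snd c ` (fst c \<inter> fst d)) \<times> UNIV" for y
        using cotangent_transition[OF assms(1,2), of "fst y" "snd y"] that
        by (auto simp: \<phi>_def \<psi>_def \<psi>'_def)
    qed
    show "std_symplectic (F U) (F V) = std_symplectic U V" for U V
    proof -
      \<comment> \<open>\<open>\<psi>'\<close> undoes \<open>\<phi>'\<close>, so the standard
        pairing survives up to a Hessian term. That term is symmetric in U and V and cancels in the
        skew combination \<open>std_symplectic\<close>.\<close>
      have key: "\<phi>' (fst U) \<bullet> snd (F V) = fst U \<bullet> snd V + p \<bullet> H (\<phi>' (fst U)) (\<phi>' (fst V))" for U V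
      proof -
        have "linear (\<lambda>e. snd V \<bullet> \<psi>' (snd d q) e + p \<bullet> H e (\<phi>' (fst V)))"
          using has_derivative_linear[OF \<psi>'[OF W(2)]]
          by (intro linearI) (simp_all add: linear_add linear_scale linear_add[OF H_lin]
              linear_scale[OF H_lin] inner_add_right algebra_simps)
        from linear_euclidean_sum[OF this, of "\<phi>' (fst U)"]
        have "\<phi>' (fst U) \<bullet> snd (F V) =
            snd V \<bullet> \<psi>' (snd d q) (\<phi>' (fst U)) + p \<bullet> H (\<phi>' (fst U)) (\<phi>' (fst V))"
          by (simp add: F_def inner_sum_right mult.commute)
        then show ?thesis
          by (simp add: \<psi>\<phi> inner_commute)
      qed
      have "fst (F U) = \<phi>' (fst U)" for U
        by (simp add: F_def)
      then show ?thesis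
        using key[of U V] key[of V U] H_sym[of "\<phi>' (fst U)" "\<phi>' (fst V)"]
        by (simp add: std_symplectic_def inner_commute)
    qed
  qed
qed

sublocale cot: differentiable_atlas "cotangent_atlas B"
proof
  show "inj_on (snd c) (fst c)" if "c \<in> cotangent_atlas B" for c
    using that cotangent_chart_inj by (auto simp: cotangent_atlas_def)
  show "open (snd c ` (fst c \<inter> fst d))" if cd: "c \<in> cotangent_atlas B" "d \<in> cotangent_atlas B" for c d
  proof -
    obtain a b where ab: "a \<in> B" "b \<in> B" "c = cotangent_chart B a" "d = cotangent_chart B b"
      using cd unfolding cotangent_atlas_def by blast
    show ?thesis
      unfolding ab(3,4) cotangent_chart_overlap[OF ab(1,2)]
      using base.open_overlap[OF ab(1,2)] by (rule open_Times) simp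
  qed
  show "transition c d differentiable at (snd c z)"
    if cd: "c \<in> cotangent_atlas B" "d \<in> cotangent_atlas B" and z: "z \<in> fst c" "z \<in> fst d" for c d z
  proof -
    obtain a b where ab: "a \<in> B" "b \<in> B" "c = cotangent_chart B a" "d = cotangent_chart B b"
      using cd unfolding cotangent_atlas_def by blast
    show ?thesis
      using cotangent_transition_derivative[OF ab(1,2)] z unfolding ab(3,4) differentiable_def by metis
  qed
qed

text \<open>Removes the choice of chart d from the definition: components in d are the images of
  those in c under the derivative F of the transition, and F preserves
  \<open>std_symplectic\<close>.\<close>

lemma canonical_symplectic_form_chart:
  assumes "c \<in> cotangent_atlas B" "z \<in> fst c"
    and "X \<in> tangent_space (cotangent_atlas B) z" "Y \<in> tangent_space (cotangent_atlas B) z"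
  shows "canonical_symplectic_form B z X Y = std_symplectic (X c) (Y c)"
proof -
  define d where "d = (SOME c. c \<in> cotangent_atlas B \<and> z \<in> fst c)"
  have d: "d \<in> cotangent_atlas B" "z \<in> fst d"
    using someI[of "\<lambda>c. c \<in> cotangent_atlas B \<and> z \<in> fst c" c] assms(1,2) unfolding d_def by auto
  obtain a b where ab: "a \<in> B" "b \<in> B" "c = cotangent_chart B a" "d = cotangent_chart B b"
    using assms(1) d(1) unfolding cotangent_atlas_def by blast
  obtain F where F: "(transition c d has_derivative F) (at (snd c z))"
    "\<And>U V. std_symplectic (F U) (F V) = std_symplectic U V"
    using cotangent_transition_derivative[OF ab(1,2), folded ab(3,4), OF assms(2) d(2)] by metis
  have "X d = F (X c)" "Y d = F (Y c)"
    using cot.tangent_vec_transition[OF _ assms(1) d(1) assms(2) d(2)] assms(3,4)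
      frechet_derivative_at[OF F(1)] by metis+
  then show ?thesis
    using F(2) by (simp add: canonical_symplectic_form_def std_symplectic_def d_def Let_def)
qed

end

section \<open>Alternating forms on a four-dimensional symplectic vector space\<close>

definition alternating :: "('v::real_vector \<Rightarrow> 'v \<Rightarrow> real) \<Rightarrow> bool"
  where "alternating a \<longleftrightarrow> bilinear a \<and> (\<forall>x. a x x = 0)"

lemma alternating_skew:
  assumes "alternating a"
  shows "a x y = - a y x"
proof -
  have b: "bilinear a" and z: "\<And>x. a x x = 0"
    using assms by (auto simp: alternating_def)
  have "a (x + y) (x + y) = a x x + a x y + (a y x + a y y)"
    by (simp add: bilinear_ladd[OF b] bilinear_radd[OF b])
  then show ?thesis
    by (simp add: z)
qed

text \<open>These four are the coordinate vectors of the Darboux coordinates x, y, p, q, in this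
  order.\<close>

definition ex1 :: "(real^2) \<times> (real^2)" where "ex1 = (axis 1 1, 0)"
definition ex2 :: "(real^2) \<times> (real^2)" where "ex2 = (axis 2 1, 0)"
definition ep1 :: "(real^2) \<times> (real^2)" where "ep1 = (0, axis 1 1)"
definition ep2 :: "(real^2) \<times> (real^2)" where "ep2 = (0, axis 2 1)"

lemma expansion4:
  fixes X :: "(real^2) \<times> (real^2)"
  shows "X = fst X $ 1 *\<^sub>R ex1 + fst X $ 2 *\<^sub>R ex2 + snd X $ 1 *\<^sub>R ep1 + snd X $ 2 *\<^sub>R ep2"
  by (simp add: prod_eq_iff vec_eq_iff forall_2 ex1_def ex2_def ep1_def ep2_def axis_def)

lemma inner_basis4:
  fixes X :: "(real^2) \<times> (real^2)"
  shows "X \<bullet> ex1 = fst X $ 1" "X \<bullet> ex2 = fst X $ 2" "X \<bullet> ep1 = snd X $ 1" "X \<bullet> ep2 = snd X $ 2"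
  by (simp_all add: ex1_def ex2_def ep1_def ep2_def inner_prod_def inner_axis)

text \<open>Reduces a form to its six independent coefficients, which turns the wedge identities
  below into polynomial identities.\<close>

lemma alternating_expansion:
  assumes "alternating a"
  shows "a X Y = a ex1 ex2 * (fst X $ 1 * fst Y $ 2 - fst X $ 2 * fst Y $ 1)
    + a ex1 ep1 * (fst X $ 1 * snd Y $ 1 - snd X $ 1 * fst Y $ 1)
    + a ex1 ep2 * (fst X $ 1 * snd Y $ 2 - snd X $ 2 * fst Y $ 1)
    + a ex2 ep1 * (fst X $ 2 * snd Y $ 1 - snd X $ 1 * fst Y $ 2)
    + a ex2 ep2 * (fst X $ 2 * snd Y $ 2 - snd X $ 2 * fst Y $ 2)
    + a ep1 ep2 * (snd X $ 1 * snd Y $ 2 - snd X $ 2 * snd Y $ 1)"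
proof -
  have b: "bilinear a" and z: "\<And>x. a x x = 0"
    using assms by (auto simp: alternating_def)
  have sk: "a ex2 ex1 = - a ex1 ex2" "a ep1 ex1 = - a ex1 ep1" "a ep2 ex1 = - a ex1 ep2"
    "a ep1 ex2 = - a ex2 ep1" "a ep2 ex2 = - a ex2 ep2" "a ep2 ep1 = - a ep1 ep2"
    using alternating_skew[OF assms] by blast+
  have "a X Y = a (fst X $ 1 *\<^sub>R ex1 + fst X $ 2 *\<^sub>R ex2 + snd X $ 1 *\<^sub>R ep1 + snd X $ 2 *\<^sub>R ep2)
     (fst Y $ 1 *\<^sub>R ex1 + fst Y $ 2 *\<^sub>R ex2 + snd Y $ 1 *\<^sub>R ep1 + snd Y $ 2 *\<^sub>R ep2)"
    using expansion4[of X] expansion4[of Y] by simp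
  then show ?thesis
    by (simp add: bilinear_ladd[OF b] bilinear_radd[OF b] bilinear_lmul[OF b] bilinear_rmul[OF b] z sk)
       (simp add: algebra_simps)
qed

lemma std_symplectic_expansion:
  fixes X :: "(real^2) \<times> (real^2)"
  shows "std_symplectic X Y = fst X $ 1 * snd Y $ 1 + fst X $ 2 * snd Y $ 2
    - snd X $ 1 * fst Y $ 1 - snd X $ 2 * fst Y $ 2"
  by (simp add: std_symplectic_def inner_vec_def sum_2)

text \<open>The classical Pfaffian of the matrix of a in the ordered basis
  \<open>ex1, ep1, ex2, ep2\<close>, in which \<open>std_symplectic\<close> has Pfaffian 1.\<close>

definition pfaffian :: "((real^2) \<times> (real^2) \<Rightarrow> (real^2) \<times> (real^2) \<Rightarrow> real) \<Rightarrow> real"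
  where "pfaffian a = a ex1 ep1 * a ex2 ep2 - a ex1 ex2 * a ep1 ep2 - a ex1 ep2 * a ex2 ep1"

text \<open>The 4-forms on a 4-dimensional space form a line; \<open>pfaffian a\<close> is the ratio
  of the two squares on it.\<close>

lemma wedge_self:
  assumes "alternating a"
  shows "wedge a a X1 X2 X3 X4 = pfaffian a * wedge std_symplectic std_symplectic X1 X2 X3 X4"
  unfolding wedge_def alternating_expansion[OF assms, of X1] alternating_expansion[OF assms, of X2]
    alternating_expansion[OF assms, of X3] std_symplectic_expansion pfaffian_def
  by algebra

text \<open>The square of dx \<and> dp + dy \<and> dq is 2 dx \<and> dp \<and> dy \<and> dq, and
  listing both positions before both momenta costs a sign. That the value is nonzero is what makes
  Pf unique.\<close>

lemma wedge_std_symplectic_basis: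
  "wedge std_symplectic std_symplectic ex1 ex2 ep1 ep2 = -2"
  by (simp add: wedge_def std_symplectic_expansion ex1_def ex2_def ep1_def ep2_def axis_def)

text \<open>The right-hand side is -1/2 times the trace of \<open>std_pi \<circ> form_rep a\<close>,
  that is, of A in the chart.\<close>

lemma wedge_std_symplectic_form_basis:
  "wedge std_symplectic a ex1 ex2 ep1 ep2 = - a ex2 ep2 - a ex1 ep1"
  by (simp add: wedge_def std_symplectic_expansion ex1_def ex2_def ep1_def ep2_def axis_def)

text \<open>The coordinate expression of X |-> a(X, .), with covectors written as component
  vectors.\<close>

definition form_rep :: "('v::euclidean_space \<Rightarrow> 'v \<Rightarrow> real) \<Rightarrow> 'v \<Rightarrow> 'v"
  where "form_rep a X = (\<Sum>b\<in>Basis. a X b *\<^sub>R b)"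

lemma form_rep_inner:
  assumes "bilinear a"
  shows "form_rep a X \<bullet> Y = a X Y"
  using linear_euclidean_sum[of "a X" Y] assms
  by (simp add: form_rep_def bilinear_def inner_sum_left inner_sum_right inner_commute[of _ Y] mult.commute)

lemma linear_form_rep:
  assumes "bilinear a"
  shows "linear (form_rep a)"
  by (intro linearI)
     (simp_all add: form_rep_def bilinear_ladd[OF assms] bilinear_lmul[OF assms]
      scaleR_add_left sum.distrib scaleR_sum_right)

text \<open>The coordinate expression of the inverse of \<open>\<Omega>\<^sub>#\<close>; the sign is
  fixed by \<open>std_symplectic_std_pi\<close>.\<close>

definition std_pi :: "'e::real_inner \<times> 'e \<Rightarrow> 'e \<times> 'e"
  where "std_pi w = (snd w, - fst w)"

lemma linear_std_pi: "linear std_pi"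
  by (intro linearI) (simp_all add: std_pi_def)

lemma std_symplectic_std_pi: "std_symplectic (std_pi w) Y = w \<bullet> Y"
  by (simp add: std_symplectic_def std_pi_def inner_prod_def)

lemma std_symplectic_inner: "std_symplectic X Y = (- snd X, fst X) \<bullet> Y"
  by (simp add: std_symplectic_def inner_prod_def)

lemma alternating_std_symplectic: "alternating std_symplectic"
  by (auto simp: alternating_def bilinear_def std_symplectic_def inner_commute
      inner_add_right inner_diff_right algebra_simps intro!: linearI)

lemma bilinear_std_symplectic: "bilinear std_symplectic"
  using alternating_std_symplectic unfolding alternating_def by blast

text \<open>This is \<open>A\<^sup>2 = - Pf Id\<close> with \<open>\<Omega>\<^sub>#\<close> applied
  to both sides, since (- snd X, fst X) is \<open>\<Omega>\<^sub>#\<close> of X. In this form it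
  yields both the square of \<rho> and a right inverse of \<open>\<alpha>\<^sub>#\<close>.\<close>

lemma form_rep_std_pi_form_rep:
  assumes a: "alternating a" and wedge: "\<And>X1 X2 X3 X4. wedge std_symplectic a X1 X2 X3 X4 = 0"
  shows "form_rep a (std_pi (form_rep a X)) = - pfaffian a *\<^sub>R (- snd X, fst X)"
proof -
  have b: "bilinear a"
    using a by (simp add: alternating_def)
  have tr: "a ex2 ep2 = - a ex1 ep1"
    using wedge[of ex1 ex2 ep1 ep2] by (simp add: wedge_std_symplectic_form_basis)
  define Z where "Z = std_pi (form_rep a X)"
  have Z: "fst Z $ 1 = a X ep1" "fst Z $ 2 = a X ep2" "snd Z $ 1 = - a X ex1" "snd Z $ 2 = - a X ex2"
    using inner_basis4[of "form_rep a X"] by (simp_all add: Z_def std_pi_def form_rep_inner[OF b])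
  have ex: "fst ex1 $ 1 = 1" "fst ex1 $ 2 = 0" "snd ex1 $ 1 = 0" "snd ex1 $ 2 = 0"
    "fst ex2 $ 1 = 0" "fst ex2 $ 2 = 1" "snd ex2 $ 1 = 0" "snd ex2 $ 2 = 0"
    "fst ep1 $ 1 = 0" "fst ep1 $ 2 = 0" "snd ep1 $ 1 = 1" "snd ep1 $ 2 = 0"
    "fst ep2 $ 1 = 0" "fst ep2 $ 2 = 0" "snd ep2 $ 1 = 0" "snd ep2 $ 2 = 1"
    by (simp_all add: ex1_def ex2_def ep1_def ep2_def axis_def)
  \<comment> \<open>Once the trace condition \<open>tr\<close> has eliminated one coefficient of a,
    this is a polynomial identity in the remaining five and in the components of X and Y.\<close>
  have "a Z Y = - pfaffian a * std_symplectic X Y" for Y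
    unfolding alternating_expansion[OF a, of Z] Z alternating_expansion[OF a, of X] ex
      pfaffian_def std_symplectic_expansion tr
    by algebra
  then have "form_rep a Z \<bullet> Y = (- pfaffian a *\<^sub>R (- snd X, fst X)) \<bullet> Y" for Y
    unfolding form_rep_inner[OF b] inner_scaleR_left std_symplectic_inner .
  then show ?thesis
    unfolding Z_def[symmetric] using vector_eq_rdot by blast
qed

section \<open>Generalized structures in charts\<close>

context differentiable_atlas
begin

definition chart_form where "chart_form \<sigma> c z e f = \<sigma> z (coord_vec M c z e) (coord_vec M c z f)"

lemma carrierE:
  assumes "z \<in> carrier M"
  obtains c where "c \<in> M" "z \<in> fst c"
  using assms unfolding carrier_def by blast

lemma chart_inv_carrier: "c \<in> M \<Longrightarrow> x \<in> chart_range c \<Longrightarrow> chart_inv c x \<in> carrier M"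
  using chart_inv_range[of x c] by (auto simp only: carrier_def)

lemma two_form_linear:
  assumes "two_form M \<sigma>" "z \<in> carrier M" "X \<in> tangent_space M z"
  shows "linear_on (tangent_space M z) (\<sigma> z X)" "linear_on (tangent_space M z) (\<lambda>Y. \<sigma> z Y X)"
  using bspec[OF conjunct1[OF assms(1)[unfolded two_form_def]] assms(2)] assms(3) by simp_all

lemma alternating_chart_form:
  assumes "two_form M \<sigma>" "c \<in> M" "z \<in> fst c"
  shows "alternating (chart_form \<sigma> c z)"
proof -
  have z: "z \<in> carrier M"
    using assms by (auto simp: carrier_def)
  have "linear (chart_form \<sigma> c z e)" "linear (\<lambda>e. chart_form \<sigma> c z e f)" for e f
    using linear_on_coord_vec[OF two_form_linear(1)[OF assms(1) z coord_vec_tangent[OF assms(2,3)]] assms(2,3)]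
     linear_on_coord_vec[OF two_form_linear(2)[OF assms(1) z coord_vec_tangent[OF assms(2,3)]] assms(2,3)]
    by (simp_all add: chart_form_def[abs_def])
  moreover have "chart_form \<sigma> c z e e = 0" for e
    using assms(1) z coord_vec_tangent[OF assms(2,3)] unfolding chart_form_def two_form_def by blast
  ultimately show ?thesis
    by (simp add: alternating_def bilinear_def)
qed

lemma chart_form_tangent:
  assumes "c \<in> M" "z \<in> fst c" "X \<in> tangent_space M z" "Y \<in> tangent_space M z"
  shows "\<sigma> z X Y = chart_form \<sigma> c z (X c) (Y c)"
  using assms by (simp add: chart_form_def coord_vec_tangent_vec)

lemma smooth_chart_form:
  assumes "two_form M \<sigma>" "c \<in> M"
  shows "smooth_on (\<lambda>x. chart_form \<sigma> c (chart_inv c x) e f) (chart_range c)"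
  using assms unfolding two_form_def Let_def chart_form_def by blast

text \<open>\<open>two_form\<close> gives smoothness on constant coordinate vectors only; linearity
  in the first argument reduces a moving vector h x to these.\<close>

lemma smooth_form_rep:
  assumes "two_form M \<sigma>" "c \<in> M" "smooth_on h (chart_range c)"
  shows "smooth_on (\<lambda>x. form_rep (chart_form \<sigma> c (chart_inv c x)) (h x)) (chart_range c)"
proof -
  note op = open_chart_range[OF assms(2)]
  have "smooth_on (\<lambda>x. \<Sum>b\<in>Basis. (\<Sum>e\<in>Basis. (h x \<bullet> e) *\<^sub>R chart_form \<sigma> c (chart_inv c x) e b) *\<^sub>R b)
      (chart_range c)"
    by (intro smooth_on_sum smooth_on_scaleR op smooth_on_const smooth_chart_form assms
        smooth_on_bounded_linear[OF bounded_linear_inner_left])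
  then show ?thesis
  proof (rule smooth_on_cong[OF op])
    fix x
    assume x: "x \<in> chart_range c"
    have "linear (\<lambda>e. chart_form \<sigma> c (chart_inv c x) e b)" for b
      using alternating_chart_form[OF assms(1,2)] chart_inv_range[OF x]
      by (simp add: alternating_def bilinear_def)
    from linear_euclidean_sum[OF this, of "h x"]
    show "form_rep (chart_form \<sigma> c (chart_inv c x)) (h x) =
      (\<Sum>b\<in>Basis. (\<Sum>e\<in>Basis. (h x \<bullet> e) *\<^sub>R chart_form \<sigma> c (chart_inv c x) e b) *\<^sub>R b)"
      by (simp add: form_rep_def)
  qed
qed

lemma form_sharp_cotangent:
  assumes "two_form M \<sigma>" "z \<in> carrier M" "X \<in> tangent_space M z"
  shows "form_sharp M \<sigma> z X \<in> cotangent_space M z"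
  using two_form_linear(1)[OF assms]
  by (simp add: cotangent_space_def linear_on_def form_sharp_def tangent_space_add tangent_space_scaleR)

lemma form_sharp_coord:
  assumes "c \<in> M" "z \<in> fst c" "X \<in> tangent_space M z"
  shows "(\<Sum>b\<in>Basis. form_sharp M \<sigma> z X (coord_vec M c z b) *\<^sub>R b) = form_rep (chart_form \<sigma> c z) (X c)"
  using assms by (simp add: form_sharp_def form_rep_def coord_vec_tangent chart_form_def coord_vec_tangent_vec)

lemma cotangent_eqI_coord:
  assumes "c \<in> M" "z \<in> fst c" "\<xi> \<in> cotangent_space M z" "\<zeta> \<in> cotangent_space M z"
    and "(\<Sum>b\<in>Basis. \<xi> (coord_vec M c z b) *\<^sub>R b) = (\<Sum>b\<in>Basis. \<zeta> (coord_vec M c z b) *\<^sub>R b)"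
  shows "\<xi> = \<zeta>"
proof (rule cotangent_eqI[OF assms(3,4)])
  show "\<xi> X = \<zeta> X" if "X \<in> tangent_space M z" for X
    using linear_on_eq_inner[OF _ assms(1,2) that, of \<xi>] linear_on_eq_inner[OF _ assms(1,2) that, of \<zeta>]
      assms(3-5) by (simp add: cotangent_space_def)
qed

text \<open>For an alternating form a right inverse of \<open>\<sigma>\<^sub>#\<close> is enough for non-degeneracy, and it then
  represents \<open>\<pi>\<^sub>\<sigma>\<^sup>#\<close> in the chart.\<close>

lemma form_pi_coord:
  assumes "two_form M \<sigma>" "c \<in> M" "z \<in> fst c"
    and H: "\<And>w. form_rep (chart_form \<sigma> c z) (H w) = w"
    and \<xi>: "\<xi> \<in> cotangent_space M z"
  shows "form_pi M \<sigma> z \<xi> = coord_vec M c z (H (\<Sum>b\<in>Basis. \<xi> (coord_vec M c z b) *\<^sub>R b))"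
    and "form_sharp M \<sigma> z (form_pi M \<sigma> z \<xi>) = \<xi>"
    and "inj_on (form_sharp M \<sigma> z) (tangent_space M z)"
proof -
  have z: "z \<in> carrier M"
    using assms by (auto simp: carrier_def)
  let ?a = "chart_form \<sigma> c z"
  have alt: "alternating ?a"
    by (rule alternating_chart_form[OF assms(1-3)])
  then have bil: "bilinear ?a"
    by (simp add: alternating_def)
  show inj: "inj_on (form_sharp M \<sigma> z) (tangent_space M z)"
  proof (rule inj_onI)
    fix X Y
    assume X: "X \<in> tangent_space M z" and Y: "Y \<in> tangent_space M z"
      and eq: "form_sharp M \<sigma> z X = form_sharp M \<sigma> z Y"
    have "form_rep ?a (X c) = form_rep ?a (Y c)"
      using form_sharp_coord[OF assms(2,3) X, of \<sigma>] form_sharp_coord[OF assms(2,3) Y, of \<sigma>] eq by simp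
    then have "?a (X c) e = ?a (Y c) e" for e
      by (metis form_rep_inner[OF bil])
    \<comment> \<open>Skewness turns the right inverse H into a means of recovering v: every
      component w \<bullet> v can be read off from the functional \<open>?a v\<close>.\<close>
    moreover have "w \<bullet> v = - ?a v (H w)" for w v
      using form_rep_inner[OF bil, of "H w" v] alternating_skew[OF alt, of "H w" v] H[of w] by simp
    ultimately have "w \<bullet> X c = w \<bullet> Y c" for w
      by simp
    then have "X c = Y c"
      using vector_eq_ldot[of "X c" "Y c"] by blast
    then show "X = Y"
      by (rule tangent_vec_eqI[OF assms(2,3) X Y])
  qed
  let ?X = "coord_vec M c z (H (\<Sum>b\<in>Basis. \<xi> (coord_vec M c z b) *\<^sub>R b))"
  have X: "?X \<in> tangent_space M z"
    by (rule coord_vec_tangent[OF assms(2,3)])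
  have eq: "form_sharp M \<sigma> z ?X = \<xi>"
    by (rule cotangent_eqI_coord[OF assms(2,3) form_sharp_cotangent[OF assms(1) z X] \<xi>])
       (simp add: form_sharp_coord[OF assms(2,3) X] assms(2,3) H)
  show "form_pi M \<sigma> z \<xi> = ?X"
    unfolding form_pi_def using inv_into_f_f[OF inj X] eq by simp
  then show "form_sharp M \<sigma> z (form_pi M \<sigma> z \<xi>) = \<xi>"
    using eq by simp
qed

lemma cotangent_scaleR: "\<xi> \<in> cotangent_space M z \<Longrightarrow> r *\<^sub>R \<xi> \<in> cotangent_space M z"
  by (simp add: cotangent_space_def linear_on_def scaleR_fun_apply algebra_simps)

lemma gen_coord_inv_mem:
  "c \<in> M \<Longrightarrow> z \<in> fst c \<Longrightarrow> gen_coord_inv M c z w \<in> gen_tangent_space M z"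
  by (simp add: gen_coord_inv_def gen_tangent_space_def coord_vec_tangent inner_cotangent)

text \<open>The two off-diagonal blocks are inverse to each other up to \<epsilon>, so the square is
  \<epsilon>. The pairing changes by -\<epsilon> because moving a skew form to its other argument
  costs a sign. A right inverse H in each chart supplies non-degeneracy, and its smoothness that of
  the upper block.\<close>

lemma J_form_type:
  assumes \<sigma>: "two_form M \<sigma>"
    and H: "\<And>c z w. c \<in> M \<Longrightarrow> z \<in> fst c \<Longrightarrow> form_rep (chart_form \<sigma> c z) (H c z w) = w"
    and H_smooth: "\<And>c w. c \<in> M \<Longrightarrow> smooth_on (\<lambda>x. H c (chart_inv c x) w) (chart_range c)"
    and \<epsilon>: "\<epsilon> \<in> {-1, 1}"
  shows "gen_almost_type M \<epsilon> (- \<epsilon>) (J_form M \<sigma> \<epsilon>)"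
proof -
  let ?T = "tangent_space M" and ?C = "cotangent_space M"
  let ?s = "form_sharp M \<sigma>" and ?p = "form_pi M \<sigma>"
  have p_mem: "?p z \<xi> \<in> ?T z" and sp: "?s z (?p z \<xi>) = \<xi>"
    and inj: "inj_on (?s z) (?T z)" if z: "z \<in> carrier M" and \<xi>: "\<xi> \<in> ?C z" for z \<xi>
  proof -
    obtain c where c: "c \<in> M" "z \<in> fst c"
      using z by (rule carrierE)
    show "?p z \<xi> \<in> ?T z"
      unfolding form_pi_coord(1)[OF \<sigma> c H[OF c] \<xi>] by (rule coord_vec_tangent[OF c])
    show "?s z (?p z \<xi>) = \<xi>" "inj_on (?s z) (?T z)"
      using form_pi_coord(2,3)[OF \<sigma> c H[OF c] \<xi>] by blast+
  qed
  have ps: "?p z (?s z X) = X" if "z \<in> carrier M" "X \<in> ?T z" for z X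
    unfolding form_pi_def
    by (rule inv_into_f_f[OF inj[OF that(1) form_sharp_cotangent[OF \<sigma> that]] that(2)])
  have s_add: "?s z (X + Y) = ?s z X + ?s z Y" and s_scale: "?s z (r *\<^sub>R X) = r *\<^sub>R ?s z X"
    if "z \<in> carrier M" "X \<in> ?T z" "Y \<in> ?T z" for z X Y r
    using two_form_linear(2)[OF \<sigma> that(1)] that
    by (auto simp: fun_eq_iff form_sharp_def scaleR_fun_apply linear_on_def)
  have p_add: "?p z (\<xi> + \<zeta>) = ?p z \<xi> + ?p z \<zeta>" and p_scale: "?p z (r *\<^sub>R \<xi>) = r *\<^sub>R ?p z \<xi>"
    if "z \<in> carrier M" "\<xi> \<in> ?C z" "\<zeta> \<in> ?C z" for z \<xi> \<zeta> r
  proof -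
    \<comment> \<open>\<open>inv_into\<close> carries no linearity of its own; it is inherited from
      \<open>?s\<close>, whose inverse on the tangent space it is.\<close>
    have "?p z (?s z (?p z \<xi> + ?p z \<zeta>)) = ?p z \<xi> + ?p z \<zeta>"
      using that by (intro ps tangent_space_add p_mem)
    then show "?p z (\<xi> + \<zeta>) = ?p z \<xi> + ?p z \<zeta>"
      using that by (simp add: s_add p_mem sp)
    have "?p z (?s z (r *\<^sub>R ?p z \<xi>)) = r *\<^sub>R ?p z \<xi>"
      using that by (intro ps tangent_space_scaleR p_mem)
    then show "?p z (r *\<^sub>R \<xi>) = r *\<^sub>R ?p z \<xi>"
      using that s_scale[OF that(1) p_mem p_mem, OF that(1,2) that(1,2)] by (simp add: sp)
  qed
  have bmap: "gen_bundle_map M (J_form M \<sigma> \<epsilon>)"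
    unfolding gen_bundle_map_def
  proof (intro conjI ballI allI)
    fix z
    assume z: "z \<in> carrier M"
    show "J_form M \<sigma> \<epsilon> z ` gen_tangent_space M z \<subseteq> gen_tangent_space M z"
      using p_mem[OF z] form_sharp_cotangent[OF \<sigma> z] cotangent_scaleR
      by (auto simp: J_form_def gen_tangent_space_def)
    show "linear_on (gen_tangent_space M z) (J_form M \<sigma> \<epsilon> z)"
      using p_add[OF z] p_scale[OF z] s_add[OF z] s_scale[OF z]
      by (auto simp: linear_on_def J_form_def gen_tangent_space_def scaleR_add_right mult.commute)
  next
    fix c w
    assume c: "c \<in> M"
    note op = open_chart_range[OF c]
    \<comment> \<open>In the trivialisation over c the bundle map has the blocks H and \<epsilon>
      \<open>form_rep\<close>.\<close>
    have "smooth_on (\<lambda>x. (H c (chart_inv c x) (snd w),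
        \<epsilon> *\<^sub>R form_rep (chart_form \<sigma> c (chart_inv c x)) (fst w))) (chart_range c)"
      by (intro smooth_on_Pair op H_smooth c smooth_on_scaleR smooth_on_const smooth_form_rep \<sigma>)
    then show "smooth_on (\<lambda>x. let z = chart_inv c x in
        gen_coord M c z (J_form M \<sigma> \<epsilon> z (gen_coord_inv M c z w))) (chart_range c)"
    proof (rule smooth_on_cong[OF op])
      fix x
      assume x: "x \<in> chart_range c"
      define z where "z = chart_inv c x"
      have z: "z \<in> fst c"
        using chart_inv_range[OF x] by (simp add: z_def)
      have "(\<Sum>b\<in>Basis. (w' \<bullet> b) *\<^sub>R b) = w'" for w' :: 'e
        by (rule euclidean_representation)
      then have "gen_coord M c z (J_form M \<sigma> \<epsilon> z (gen_coord_inv M c z w)) =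
        (H c z (snd w), \<epsilon> *\<^sub>R form_rep (chart_form \<sigma> c z) (fst w))"
        using form_sharp_coord[OF c z coord_vec_tangent[OF c z], of \<sigma> "fst w"] c z
        by (simp add: gen_coord_def gen_coord_inv_def J_form_def coord_vec_tangent
            form_pi_coord(1)[OF \<sigma> c z H[OF c z] inner_cotangent[OF c z]]
            scaleR_fun_apply flip: scaleR_scaleR scaleR_sum_right)
      then show "(let z = chart_inv c x in gen_coord M c z (J_form M \<sigma> \<epsilon> z (gen_coord_inv M c z w))) =
        (H c (chart_inv c x) (snd w), \<epsilon> *\<^sub>R form_rep (chart_form \<sigma> c (chart_inv c x)) (fst w))"
        by (simp add: z_def Let_def)
    qed
  qed
  have skew: "\<sigma> z X Y = - \<sigma> z Y X" if z: "z \<in> carrier M" and XY: "X \<in> ?T z" "Y \<in> ?T z" for z X Y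
  proof -
    obtain c where c: "c \<in> M" "z \<in> fst c"
      using z by (rule carrierE)
    show ?thesis
      unfolding chart_form_tangent[OF c XY] chart_form_tangent[OF c XY(2,1)]
      by (rule alternating_skew[OF alternating_chart_form[OF \<sigma> c]])
  qed
  have contract: "?s z X (?p z \<zeta>) = - \<zeta> X" if z: "z \<in> carrier M" and X: "X \<in> ?T z" and \<zeta>: "\<zeta> \<in> ?C z" for z X \<zeta>
  proof -
    have "?s z X (?p z \<zeta>) = - ?s z (?p z \<zeta>) X"
      using skew[OF z X p_mem[OF z \<zeta>]] X p_mem[OF z \<zeta>] by (simp add: form_sharp_def)
    then show ?thesis
      by (simp add: sp[OF z \<zeta>])
  qed
  show ?thesis
    unfolding gen_almost_type_def
  proof (intro conjI ballI bmap)
    fix z u v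
    assume z: "z \<in> carrier M" and u: "u \<in> gen_tangent_space M z"
    then show "J_form M \<sigma> \<epsilon> z (J_form M \<sigma> \<epsilon> z u) = \<epsilon> *\<^sub>R u"
      using ps[OF z] p_scale[OF z _ _] sp[OF z] form_sharp_cotangent[OF \<sigma> z]
      by (auto simp: J_form_def gen_tangent_space_def prod_eq_iff)
    assume v: "v \<in> gen_tangent_space M z"
    show "gen_pairing (J_form M \<sigma> \<epsilon> z u) (J_form M \<sigma> \<epsilon> z v) = - \<epsilon> * gen_pairing u v"
      using u v contract[OF z]
      by (auto simp: J_form_def gen_tangent_space_def gen_pairing_def scaleR_fun_apply field_simps)
  qed
qed

text \<open>The dual of F also squares to \<gamma>, and \<epsilon>^2 = 1, so both diagonal blocks
  do. In the pairing \<xi> is evaluated on F(F X) = \<gamma> X with the factor \<epsilon>, which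
  gives \<epsilon> \<gamma>.\<close>

lemma J_endo_type:
  assumes F_mem: "\<And>z X. z \<in> carrier M \<Longrightarrow> X \<in> tangent_space M z \<Longrightarrow> F z X \<in> tangent_space M z"
    and F_lin: "\<And>z. z \<in> carrier M \<Longrightarrow> linear_on (tangent_space M z) (F z)"
    and F_square: "\<And>z X. z \<in> carrier M \<Longrightarrow> X \<in> tangent_space M z \<Longrightarrow> F z (F z X) = \<gamma> *\<^sub>R X"
    and F_smooth: "\<And>c e. c \<in> M \<Longrightarrow>
      smooth_on (\<lambda>x. F (chart_inv c x) (coord_vec M c (chart_inv c x) e) c) (chart_range c)"
    and \<epsilon>: "\<epsilon> \<in> {-1, 1}"
  shows "gen_almost_type M \<gamma> (\<epsilon> * \<gamma>) (J_endo M F \<epsilon>)"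
proof -
  let ?T = "tangent_space M" and ?C = "cotangent_space M"
  have dual_mem: "dual_endo M F z \<xi> \<in> ?C z" if "z \<in> carrier M" "\<xi> \<in> ?C z" for z \<xi>
    using that F_mem[OF that(1)] F_lin[OF that(1)] tangent_space_add tangent_space_scaleR
    by (simp add: cotangent_space_def linear_on_def dual_endo_def)
  have bmap: "gen_bundle_map M (J_endo M F \<epsilon>)"
    unfolding gen_bundle_map_def
  proof (intro conjI ballI allI)
    fix z
    assume z: "z \<in> carrier M"
    show "J_endo M F \<epsilon> z ` gen_tangent_space M z \<subseteq> gen_tangent_space M z"
      using F_mem[OF z] dual_mem[OF z] cotangent_scaleR
      by (auto simp: J_endo_def gen_tangent_space_def)
    have "dual_endo M F z (\<xi> + \<zeta>) = dual_endo M F z \<xi> + dual_endo M F z \<zeta>"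
      "dual_endo M F z (r *\<^sub>R \<xi>) = r *\<^sub>R dual_endo M F z \<xi>" for \<xi> \<zeta> r
      by (auto simp: dual_endo_def fun_eq_iff scaleR_fun_apply)
    then show "linear_on (gen_tangent_space M z) (J_endo M F \<epsilon> z)"
      using F_lin[OF z]
      by (auto simp: linear_on_def J_endo_def gen_tangent_space_def scaleR_add_right mult.commute)
  next
    fix c w
    assume c: "c \<in> M"
    note op = open_chart_range[OF c]
    have "smooth_on (\<lambda>x. (F (chart_inv c x) (coord_vec M c (chart_inv c x) (fst w)) c,
        \<Sum>b\<in>Basis. (\<epsilon> *\<^sub>R (snd w \<bullet> F (chart_inv c x) (coord_vec M c (chart_inv c x) b) c)) *\<^sub>R b)) (chart_range c)"
      by (intro smooth_on_Pair op F_smooth c smooth_on_scaleR smooth_on_const smooth_on_sum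
          smooth_on_bounded_linear[OF bounded_linear_inner_right])
    then show "smooth_on (\<lambda>x. let z = chart_inv c x in
        gen_coord M c z (J_endo M F \<epsilon> z (gen_coord_inv M c z w))) (chart_range c)"
    proof (rule smooth_on_cong[OF op])
      fix x
      assume x: "x \<in> chart_range c"
      then show "(let z = chart_inv c x in gen_coord M c z (J_endo M F \<epsilon> z (gen_coord_inv M c z w))) =
        (F (chart_inv c x) (coord_vec M c (chart_inv c x) (fst w)) c,
        \<Sum>b\<in>Basis. (\<epsilon> *\<^sub>R (snd w \<bullet> F (chart_inv c x) (coord_vec M c (chart_inv c x) b) c)) *\<^sub>R b)"
        using chart_inv_range[OF x] chart_inv_carrier[OF c x] c
        by (simp add: Let_def gen_coord_def gen_coord_inv_def J_endo_def dual_endo_def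
            scaleR_fun_apply coord_vec_tangent F_mem)
    qed
  qed
  have \<epsilon>2: "\<epsilon> * \<epsilon> = 1"
    using \<epsilon> by auto
  show ?thesis
    unfolding gen_almost_type_def
  proof (intro conjI ballI bmap)
    fix z u v
    assume z: "z \<in> carrier M" and u: "u \<in> gen_tangent_space M z"
    have "dual_endo M F z (\<epsilon> *\<^sub>R dual_endo M F z \<xi>) = \<epsilon> *\<^sub>R \<gamma> *\<^sub>R \<xi>" if "\<xi> \<in> ?C z" for \<xi>
    proof
      show "dual_endo M F z (\<epsilon> *\<^sub>R dual_endo M F z \<xi>) X = (\<epsilon> *\<^sub>R \<gamma> *\<^sub>R \<xi>) X" for X
        using that F_square[OF z] F_mem[OF z]
        by (auto simp: dual_endo_def scaleR_fun_apply cotangent_space_def linear_on_def)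
    qed
    then show "J_endo M F \<epsilon> z (J_endo M F \<epsilon> z u) = \<gamma> *\<^sub>R u"
      using u F_square[OF z] \<epsilon>2 by (auto simp: J_endo_def gen_tangent_space_def mult.assoc[symmetric])
    assume v: "v \<in> gen_tangent_space M z"
    have "(\<epsilon> *\<^sub>R dual_endo M F z \<xi>) (F z X) = \<epsilon> * \<gamma> * \<xi> X" if "\<xi> \<in> ?C z" "X \<in> ?T z" for \<xi> X
      using that F_square[OF z] F_mem[OF z]
      by (simp add: dual_endo_def scaleR_fun_apply cotangent_space_def linear_on_def)
    then show "gen_pairing (J_endo M F \<epsilon> z u) (J_endo M F \<epsilon> z v) = \<epsilon> * \<gamma> * gen_pairing u v"
      using u v by (auto simp: J_endo_def gen_tangent_space_def gen_pairing_def algebra_simps)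
  qed
qed

end

section \<open>Monge-Ampere structures\<close>

lemma form_rep_std_symplectic: "form_rep std_symplectic (std_pi w) = w"
proof -
  have "form_rep std_symplectic (std_pi w) \<bullet> Y = w \<bullet> Y" for Y
    by (simp add: form_rep_inner[OF bilinear_std_symplectic] std_symplectic_std_pi)
  then show ?thesis
    using vector_eq_rdot by blast
qed

lemma std_pi_inverse: "std_pi (- snd X, fst X) = X"
  by (simp add: std_pi_def)

context smooth_base
begin

lemma chart_form_canonical:
  assumes "c \<in> cotangent_atlas B" "z \<in> fst c"
  shows "cot.chart_form (canonical_symplectic_form B) c z = std_symplectic"
  using assms by (intro ext)
    (simp add: cot.chart_form_def canonical_symplectic_form_chart[OF assms] cot.coord_vec_tangent)

lemma two_form_canonical: "two_form (cotangent_atlas B) (canonical_symplectic_form B)"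
  unfolding two_form_def
proof (intro conjI ballI allI)
  let ?M = "cotangent_atlas B"
  note bil = bilinear_std_symplectic
  fix z X
  assume z: "z \<in> carrier ?M" and X: "X \<in> tangent_space ?M z"
  obtain c where c: "c \<in> ?M" "z \<in> fst c"
    using z by (rule cot.carrierE)
  note \<Omega> = canonical_symplectic_form_chart[OF c]
  show "linear_on (tangent_space ?M z) (canonical_symplectic_form B z X)"
    using X by (simp add: linear_on_def \<Omega> cot.tangent_space_add cot.tangent_space_scaleR
        scaleR_fun_apply bilinear_radd[OF bil] bilinear_rmul[OF bil])
  show "linear_on (tangent_space ?M z) (\<lambda>Y. canonical_symplectic_form B z Y X)"
    using X by (simp add: linear_on_def \<Omega> cot.tangent_space_add cot.tangent_space_scaleR
        scaleR_fun_apply bilinear_ladd[OF bil] bilinear_lmul[OF bil])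
  show "canonical_symplectic_form B z X X = 0"
    using X by (simp add: \<Omega> std_symplectic_def inner_commute)
next
  fix c e f
  assume c: "c \<in> cotangent_atlas B"
  note op = cot.open_chart_range[OF c]
  show "smooth_on (\<lambda>x. let z = chart_inv c x in canonical_symplectic_form B z
      (coord_vec (cotangent_atlas B) c z e) (coord_vec (cotangent_atlas B) c z f)) (chart_range c)"
  proof (rule smooth_on_cong[OF op smooth_on_const[OF op, of "std_symplectic e f"]])
    fix x
    assume x: "x \<in> chart_range c"
    from fun_cong[OF fun_cong[OF chart_form_canonical[OF c conjunct1[OF cot.chart_inv_range[OF x]]]]]
    show "(let z = chart_inv c x in canonical_symplectic_form B z
        (coord_vec (cotangent_atlas B) c z e) (coord_vec (cotangent_atlas B) c z f)) = std_symplectic e f"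
      by (simp only: Let_def cot.chart_form_def)
  qed
qed

text \<open>\<Omega> has constant coefficients in cotangent charts, so the constant map
  \<open>std_pi\<close> serves as the smooth right inverse.\<close>

lemma J_canonical_type:
  assumes "\<epsilon> \<in> {-1, 1}"
  shows "gen_almost_type (cotangent_atlas B) \<epsilon> (- \<epsilon>)
    (J_form (cotangent_atlas B) (canonical_symplectic_form B) \<epsilon>)"
proof (rule cot.J_form_type[OF two_form_canonical _ _ assms])
  show "form_rep (cot.chart_form (canonical_symplectic_form B) c z) (std_pi w) = w"
    if "c \<in> cotangent_atlas B" "z \<in> fst c" for c z w
    by (simp add: chart_form_canonical[OF that] form_rep_std_symplectic)
qed (simp add: smooth_on_const cot.open_chart_range)

lemma form_pi_canonical:
  assumes "c \<in> cotangent_atlas B" "z \<in> fst c" "\<xi> \<in> cotangent_space (cotangent_atlas B) z"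
  shows "form_pi (cotangent_atlas B) (canonical_symplectic_form B) z \<xi> =
    coord_vec (cotangent_atlas B) c z (std_pi (\<Sum>b\<in>Basis. \<xi> (coord_vec (cotangent_atlas B) c z b) *\<^sub>R b))"
  using assms by (intro cot.form_pi_coord(1)[OF two_form_canonical])
    (simp_all add: chart_form_canonical form_rep_std_symplectic)

end

section \<open>The Pfaffian, the inverse of \<alpha> and the endomorphism \<rho>\<close>

locale monge_ampere_structure = smooth_base B for B :: "('p, real^2) chart set" +
  fixes \<alpha> :: "'p surface_two_form"
  assumes ma: "monge_ampere B \<alpha>" and nondeg: "ma_nondegenerate B \<alpha>"
begin

abbreviation "M \<equiv> cotangent_atlas B"
abbreviation "\<alpha>\<^sub>c \<equiv> cot.chart_form \<alpha>"

lemma two_form_\<alpha>: "two_form M \<alpha>"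
  using ma by (simp add: monge_ampere_def)

lemma wedge_chart:
  assumes "c \<in> M" "z \<in> fst c" "X1 \<in> tangent_space M z" "X2 \<in> tangent_space M z"
    "X3 \<in> tangent_space M z" "X4 \<in> tangent_space M z"
  shows "wedge (\<sigma> z) (\<tau> z) X1 X2 X3 X4 =
    wedge (cot.chart_form \<sigma> c z) (cot.chart_form \<tau> c z) (X1 c) (X2 c) (X3 c) (X4 c)"
  using assms by (simp add: wedge_def cot.chart_form_tangent[OF assms(1,2)])

lemma wedge_coord_vec:
  assumes "c \<in> M" "z \<in> fst c"
  shows "wedge (\<sigma> z) (\<tau> z) (coord_vec M c z e1) (coord_vec M c z e2) (coord_vec M c z e3) (coord_vec M c z e4) =
    wedge (cot.chart_form \<sigma> c z) (cot.chart_form \<tau> c z) e1 e2 e3 e4"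
  by (simp add: wedge_def cot.chart_form_def)

lemma mem_carrier: "c \<in> M \<Longrightarrow> z \<in> fst c \<Longrightarrow> z \<in> carrier M"
  unfolding carrier_def by blast

lemma wedge_std_\<alpha>:
  assumes "c \<in> M" "z \<in> fst c"
  shows "wedge std_symplectic (\<alpha>\<^sub>c c z) X1 X2 X3 X4 = 0"
  using ma mem_carrier[OF assms]
  by (simp add: monge_ampere_def cot.coord_vec_tangent[OF assms]
      flip: chart_form_canonical[OF assms] wedge_coord_vec[OF assms])

text \<open>Existence in the definite description is \<open>wedge_self\<close>; uniqueness follows
  by evaluating on the coordinate basis, where \<Omega> \<and> \<Omega> does not vanish.\<close>

lemma Pf_chart:
  assumes c: "c \<in> M" "z \<in> fst c"
  shows "Pf B \<alpha> z = pfaffian (\<alpha>\<^sub>c c z)"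
  unfolding Pf_def
proof (rule the_equality)
  let ?\<Omega> = "canonical_symplectic_form B"
  have alt: "alternating (\<alpha>\<^sub>c c z)"
    by (rule cot.alternating_chart_form[OF two_form_\<alpha> c])
  show "\<forall>X1\<in>tangent_space M z. \<forall>X2\<in>tangent_space M z. \<forall>X3\<in>tangent_space M z. \<forall>X4\<in>tangent_space M z.
      wedge (\<alpha> z) (\<alpha> z) X1 X2 X3 X4 = pfaffian (\<alpha>\<^sub>c c z) * wedge (?\<Omega> z) (?\<Omega> z) X1 X2 X3 X4"
    by (simp add: wedge_chart[OF c] chart_form_canonical[OF c] wedge_self[OF alt])
  fix r
  assume "\<forall>X1\<in>tangent_space M z. \<forall>X2\<in>tangent_space M z. \<forall>X3\<in>tangent_space M z. \<forall>X4\<in>tangent_space M z.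
      wedge (\<alpha> z) (\<alpha> z) X1 X2 X3 X4 = r * wedge (?\<Omega> z) (?\<Omega> z) X1 X2 X3 X4"
  then have "wedge (\<alpha>\<^sub>c c z) (\<alpha>\<^sub>c c z) ex1 ex2 ep1 ep2 =
      r * wedge std_symplectic std_symplectic ex1 ex2 ep1 ep2"
    by (simp add: cot.coord_vec_tangent[OF c]
        flip: chart_form_canonical[OF c] wedge_coord_vec[OF c])
  then show "r = pfaffian (\<alpha>\<^sub>c c z)"
    by (simp add: wedge_self[OF alt] wedge_std_symplectic_basis)
qed

lemma pfaffian_nonzero: "c \<in> M \<Longrightarrow> z \<in> fst c \<Longrightarrow> pfaffian (\<alpha>\<^sub>c c z) \<noteq> 0"
  using nondeg mem_carrier[of c z] by (simp add: ma_nondegenerate_def flip: Pf_chart)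

lemma smooth_pfaffian:
  assumes "c \<in> M"
  shows "smooth_on (\<lambda>x. pfaffian (\<alpha>\<^sub>c c (chart_inv c x))) (chart_range c)"
  unfolding pfaffian_def
  by (intro smooth_on_diff smooth_on_mult cot.open_chart_range[OF assms]
      cot.smooth_chart_form[OF two_form_\<alpha> assms])

definition \<alpha>_inverse where
  "\<alpha>_inverse c z w = - inverse (pfaffian (\<alpha>\<^sub>c c z)) *\<^sub>R std_pi (form_rep (\<alpha>\<^sub>c c z) (std_pi w))"

lemma form_rep_\<alpha>_inverse:
  assumes c: "c \<in> M" "z \<in> fst c"
  shows "form_rep (\<alpha>\<^sub>c c z) (\<alpha>_inverse c z w) = w"
proof -
  have alt: "alternating (\<alpha>\<^sub>c c z)"
    by (rule cot.alternating_chart_form[OF two_form_\<alpha> c])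
  then have lin: "linear (form_rep (\<alpha>\<^sub>c c z))"
    by (simp add: linear_form_rep alternating_def)
  \<comment> \<open>\<open>form_rep_std_pi_form_rep\<close> at X = \<open>std_pi w\<close> returns
    -Pf times w, which the scalar in \<open>\<alpha>_inverse\<close> normalises.\<close>
  show ?thesis
    unfolding \<alpha>_inverse_def linear_scale[OF lin] form_rep_std_pi_form_rep[OF alt wedge_std_\<alpha>[OF c]]
    using pfaffian_nonzero[OF c] by (simp add: std_pi_def)
qed

lemma smooth_\<alpha>_inverse:
  assumes "c \<in> M"
  shows "smooth_on (\<lambda>x. \<alpha>_inverse c (chart_inv c x) w) (chart_range c)"
proof -
  note op = cot.open_chart_range[OF assms]
  have "bounded_linear (std_pi :: (real^2) \<times> (real^2) \<Rightarrow> _)"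
    using linear_std_pi linear_conv_bounded_linear by blast
  then show ?thesis
    unfolding \<alpha>_inverse_def
    using pfaffian_nonzero[OF assms conjunct1[OF cot.chart_inv_range]]
    by (intro smooth_on_scaleR smooth_on_minus smooth_on_inverse smooth_pfaffian assms op
        smooth_on_bounded_linear[of std_pi] cot.smooth_form_rep two_form_\<alpha> smooth_on_const) simp_all
qed

lemma J_\<alpha>_type: "\<epsilon> \<in> {-1, 1} \<Longrightarrow> gen_almost_type M \<epsilon> (- \<epsilon>) (J_form M \<alpha> \<epsilon>)"
  by (rule cot.J_form_type[OF two_form_\<alpha> form_rep_\<alpha>_inverse smooth_\<alpha>_inverse])

lemma ma_rho_chart:
  assumes c: "c \<in> M" "z \<in> fst c" and X: "X \<in> tangent_space M z"
  shows "ma_rho B \<alpha> z X \<in> tangent_space M z"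
    and "ma_rho B \<alpha> z X c = \<bar>Pf B \<alpha> z\<bar> powr (-1/2) *\<^sub>R std_pi (form_rep (\<alpha>\<^sub>c c z) (X c))"
proof -
  have eq: "ma_rho B \<alpha> z X = \<bar>Pf B \<alpha> z\<bar> powr (-1/2) *\<^sub>R
      coord_vec M c z (std_pi (form_rep (\<alpha>\<^sub>c c z) (X c)))"
    unfolding ma_rho_def
      form_pi_canonical[OF c cot.form_sharp_cotangent[OF two_form_\<alpha> mem_carrier[OF c] X]]
      cot.form_sharp_coord[OF c X] ..
  show "ma_rho B \<alpha> z X \<in> tangent_space M z"
    unfolding eq by (intro cot.tangent_space_scaleR cot.coord_vec_tangent c)
  show "ma_rho B \<alpha> z X c = \<bar>Pf B \<alpha> z\<bar> powr (-1/2) *\<^sub>R std_pi (form_rep (\<alpha>\<^sub>c c z) (X c))"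
    unfolding eq scaleR_fun_apply by (simp add: c)
qed

text \<open>The constant s is the sign of Pf: 1 in the elliptic and -1 in the hyperbolic case. It
  makes s Pf a smooth positive expression for |Pf|.\<close>

lemma J_rho_type:
  assumes s: "s \<in> {-1, 1}" and sPf: "\<And>z. z \<in> carrier M \<Longrightarrow> s * Pf B \<alpha> z > 0"
    and \<epsilon>: "\<epsilon> \<in> {-1, 1}"
  shows "gen_almost_type M (- s) (\<epsilon> * - s) (J_endo M (ma_rho B \<alpha>) \<epsilon>)"
proof (rule cot.J_endo_type[OF _ _ _ _ \<epsilon>])
  have abs_Pf: "\<bar>Pf B \<alpha> z\<bar> = s * Pf B \<alpha> z" if "z \<in> carrier M" for z
    using s sPf[OF that] by auto
  fix z
  assume z: "z \<in> carrier M"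
  obtain c where c: "c \<in> M" "z \<in> fst c"
    using z by (rule cot.carrierE)
  have alt: "alternating (\<alpha>\<^sub>c c z)"
    by (rule cot.alternating_chart_form[OF two_form_\<alpha> c])
  then have lin: "linear (form_rep (\<alpha>\<^sub>c c z))"
    by (simp add: linear_form_rep alternating_def)
  note \<rho>_mem = ma_rho_chart(1)[OF c] and \<rho> = ma_rho_chart(2)[OF c]
  show "ma_rho B \<alpha> z X \<in> tangent_space M z" if "X \<in> tangent_space M z" for X
    by (rule \<rho>_mem[OF that])
  show "linear_on (tangent_space M z) (ma_rho B \<alpha> z)"
    unfolding linear_on_def
  proof (intro conjI ballI allI)
    fix X Y r
    assume X: "X \<in> tangent_space M z"
    show "ma_rho B \<alpha> z (r *\<^sub>R X) = r *\<^sub>R ma_rho B \<alpha> z X"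
      by (rule cot.tangent_vec_eqI[OF c])
         (simp_all add: X \<rho>_mem \<rho> cot.tangent_space_scaleR scaleR_fun_apply linear_scale[OF lin]
           linear_scale[OF linear_std_pi])
    assume Y: "Y \<in> tangent_space M z"
    show "ma_rho B \<alpha> z (X + Y) = ma_rho B \<alpha> z X + ma_rho B \<alpha> z Y"
      by (rule cot.tangent_vec_eqI[OF c])
         (simp_all add: X Y \<rho>_mem \<rho> cot.tangent_space_add linear_add[OF lin]
           linear_add[OF linear_std_pi] scaleR_add_right)
  qed
  show "ma_rho B \<alpha> z (ma_rho B \<alpha> z X) = - s *\<^sub>R X" if X: "X \<in> tangent_space M z" for X
  proof (rule cot.tangent_vec_eqI[OF c])
    let ?P = "Pf B \<alpha> z"
    have P: "?P \<noteq> 0"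
      using sPf[OF z] by auto
    \<comment> \<open>The two normalising factors multiply to 1/|Pf|, so the factor -Pf from the
      square of A is reduced to minus the sign of Pf.\<close>
    have "\<bar>?P\<bar> powr (-1/2) * \<bar>?P\<bar> powr (-1/2) * - ?P = - s"
    proof -
      have "\<bar>?P\<bar> powr (-1/2) * \<bar>?P\<bar> powr (-1/2) = inverse \<bar>?P\<bar>"
        using P by (simp only: powr_add[symmetric]) (simp add: powr_minus)
      then show ?thesis
        using s P sPf[OF z] by (auto simp: abs_Pf[OF z])
    qed
    then have "(\<bar>?P\<bar> powr (-1/2) * \<bar>?P\<bar> powr (-1/2)) *\<^sub>R - ?P *\<^sub>R X c = - s *\<^sub>R X c"
      by (metis scaleR_scaleR)
    then show "ma_rho B \<alpha> z (ma_rho B \<alpha> z X) c = (- s *\<^sub>R X) c"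
      by (simp only: \<rho>[OF \<rho>_mem[OF X]] \<rho>[OF X] linear_scale[OF lin] linear_scale[OF linear_std_pi]
          form_rep_std_pi_form_rep[OF alt wedge_std_\<alpha>[OF c]] Pf_chart[OF c, symmetric] std_pi_inverse
          scaleR_scaleR scaleR_fun_apply mult.assoc)
  qed (simp_all only: \<rho>_mem X cot.tangent_space_scaleR)
next
  have abs_Pf: "\<bar>Pf B \<alpha> z\<bar> = s * Pf B \<alpha> z" if "z \<in> carrier M" for z
    using s sPf[OF that] by auto
  fix c e
  assume c: "c \<in> M"
  note op = cot.open_chart_range[OF c]
  have bl: "bounded_linear (std_pi :: (real^2) \<times> (real^2) \<Rightarrow> _)"
    using linear_std_pi linear_conv_bounded_linear by blast
  have "smooth_on (\<lambda>x. (s * pfaffian (\<alpha>\<^sub>c c (chart_inv c x))) powr (-1/2) *\<^sub>R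
      std_pi (form_rep (\<alpha>\<^sub>c c (chart_inv c x)) e)) (chart_range c)"
  proof (intro smooth_on_scaleR op smooth_on_powr smooth_on_mult smooth_on_const smooth_pfaffian c
      smooth_on_bounded_linear[OF bl] cot.smooth_form_rep two_form_\<alpha>)
    fix x
    assume x: "x \<in> chart_range c"
    show "0 < s * pfaffian (\<alpha>\<^sub>c c (chart_inv c x))"
      using sPf[OF cot.chart_inv_carrier[OF c x]] Pf_chart[OF c] cot.chart_inv_range[OF x] by simp
  qed
  then show "smooth_on (\<lambda>x. ma_rho B \<alpha> (chart_inv c x) (coord_vec M c (chart_inv c x) e) c)
      (chart_range c)"
  proof (rule smooth_on_cong[OF op])
    fix x
    assume x: "x \<in> chart_range c"
    have z: "chart_inv c x \<in> fst c"
      using cot.chart_inv_range[OF x] by blast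
    show "ma_rho B \<alpha> (chart_inv c x) (coord_vec M c (chart_inv c x) e) c =
      (s * pfaffian (\<alpha>\<^sub>c c (chart_inv c x))) powr (-1/2) *\<^sub>R
      std_pi (form_rep (\<alpha>\<^sub>c c (chart_inv c x)) e)"
      unfolding ma_rho_chart(2)[OF c z cot.coord_vec_tangent[OF c z]]
        Pf_chart[OF c z] abs_Pf[OF mem_carrier[OF c z], unfolded Pf_chart[OF c z]] cot.coord_vec_self[OF c z] ..
  qed
qed

text \<open>Equality of the two structures would force \<open>\<alpha> = \<Omega>\<close> at every point, contradicting
  \<open>\<Omega> \<and> \<alpha> = 0\<close>.\<close>

lemma J_\<alpha>_neq_J_canonical:
  assumes "carrier B \<noteq> {}"
  shows "\<not> gen_endo_eq M (J_form M \<alpha> \<epsilon>) (J_form M (canonical_symplectic_form B) \<epsilon>')"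
proof
  assume eq: "gen_endo_eq M (J_form M \<alpha> \<epsilon>) (J_form M (canonical_symplectic_form B) \<epsilon>')"
  obtain q d where d: "d \<in> B" "q \<in> fst d"
    using assms unfolding carrier_def by blast
  define c where "c = cotangent_chart B d"
  \<comment> \<open>Since the base is nonempty, its zero section supplies a point at which to
    compare.\<close>
  define z where "z = (q, covector d q 0)"
  have c: "c \<in> M" "z \<in> fst c"
    using d covector_mem[OF d d(2)] by (auto simp: c_def z_def cotangent_atlas_def)
  let ?a = "\<alpha>\<^sub>c c z"
  have a: "bilinear ?a"
    using cot.alternating_chart_form[OF two_form_\<alpha> c] by (simp add: alternating_def)
  \<comment> \<open>The structures are compared on pairs (0, \<xi>), where only the upper blocks
    act, so the signs \<open>\<epsilon>\<close> and \<open>\<epsilon>'\<close> do not interfere. The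
    covector \<xi> is chosen with components w in c.\<close>
  have rep: "form_rep ?a (std_pi w) = w" for w
  proof -
    define \<xi> where "\<xi> = snd (gen_coord_inv M c z (0, w))"
    have \<xi>: "\<xi> \<in> cotangent_space M z"
      unfolding \<xi>_def gen_coord_inv_def snd_conv by (rule cot.inner_cotangent[OF c])
    have w: "(\<Sum>b\<in>Basis. \<xi> (coord_vec M c z b) *\<^sub>R b) = w"
      by (simp add: \<xi>_def gen_coord_inv_def cot.coord_vec_tangent[OF c] c euclidean_representation)
    have "gen_coord_inv M c z (0, w) \<in> gen_tangent_space M z"
      by (rule cot.gen_coord_inv_mem[OF c])
    then have "form_pi M \<alpha> z \<xi> = form_pi M (canonical_symplectic_form B) z \<xi>"
      using eq mem_carrier[OF c]
      by (auto simp: gen_endo_eq_def J_form_def \<xi>_def split_beta)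
    then have "coord_vec M c z (\<alpha>_inverse c z w) = coord_vec M c z (std_pi w)"
      using cot.form_pi_coord(1)[OF two_form_\<alpha> c form_rep_\<alpha>_inverse[OF c] \<xi>]
        form_pi_canonical[OF c \<xi>] by (simp add: w)
    then have "\<alpha>_inverse c z w = std_pi w"
      by (metis cot.coord_vec_self[OF c])
    then show ?thesis
      using form_rep_\<alpha>_inverse[OF c] by metis
  qed
  have "?a X Y = std_symplectic X Y" for X Y
    using form_rep_inner[OF a, of X Y] rep[of "(- snd X, fst X)"]
    by (simp add: std_pi_inverse std_symplectic_inner)
  then have "?a = std_symplectic"
    by blast
  \<comment> \<open>With \<alpha> = \<Omega> at z, the vanishing \<Omega> \<and> \<alpha> would be
    \<Omega> \<and> \<Omega>, whose value on the basis is -2.\<close>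
  then show False
    using wedge_std_\<alpha>[OF c, of ex1 ex2 ep1 ep2] by (simp add: wedge_std_symplectic_basis)
qed

end

theorem proposition3p2:
  fixes B :: "('p, real^2) chart set"
    and \<alpha> :: "'p surface_two_form"
    and \<epsilon>1 \<epsilon>2 \<epsilon>3 :: real
  defines "M \<equiv> cotangent_atlas B"
    and "\<Omega> \<equiv> canonical_symplectic_form B"
  defines "J\<rho> \<equiv> J_endo M (ma_rho B \<alpha>) \<epsilon>1"
    and "J\<alpha> \<equiv> J_form M \<alpha> \<epsilon>2"
    and "J\<Omega> \<equiv> J_form M \<Omega> \<epsilon>3"
  assumes "smooth_manifold B"
    and "monge_ampere B \<alpha>"
    and "ma_nondegenerate B \<alpha>"
    and "\<epsilon>1 \<in> {-1, 1}" and "\<epsilon>2 \<in> {-1, 1}" and "\<epsilon>3 \<in> {-1, 1}"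
  shows "(ma_elliptic B \<alpha> \<or> ma_hyperbolic B \<alpha> \<longrightarrow>
           gen_almost_structure M J\<rho> \<and> gen_almost_structure M J\<alpha> \<and> gen_almost_structure M J\<Omega>)
    \<and> (ma_elliptic B \<alpha> \<longrightarrow> (\<epsilon>1 = 1 \<longrightarrow> GaAC M J\<rho>) \<and> (\<epsilon>1 = -1 \<longrightarrow> GaC M J\<rho>))
    \<and> (ma_hyperbolic B \<alpha> \<longrightarrow> (\<epsilon>1 = 1 \<longrightarrow> GaP M J\<rho>) \<and> (\<epsilon>1 = -1 \<longrightarrow> GaPC M J\<rho>))
    \<and> (\<epsilon>2 = 1 \<longrightarrow> GaPC M J\<alpha>) \<and> (\<epsilon>2 = -1 \<longrightarrow> GaC M J\<alpha>)
    \<and> (\<epsilon>3 = 1 \<longrightarrow> GaPC M J\<Omega>) \<and> (\<epsilon>3 = -1 \<longrightarrow> GaC M J\<Omega>)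
    \<and> \<not> gen_endo_eq M J\<alpha> J\<Omega>"
proof -
  interpret monge_ampere_structure B \<alpha>
    using assms by unfold_locales (auto simp: smooth_manifold_def)
  have \<alpha>: "gen_almost_type M \<epsilon>2 (- \<epsilon>2) J\<alpha>"
    unfolding M_def J\<alpha>_def by (rule J_\<alpha>_type[OF assms(10)])
  have \<Omega>: "gen_almost_type M \<epsilon>3 (- \<epsilon>3) J\<Omega>"
    unfolding M_def J\<Omega>_def \<Omega>_def by (rule J_canonical_type[OF assms(11)])
  have ell: "gen_almost_type M (-1) (- \<epsilon>1) J\<rho>" if "ma_elliptic B \<alpha>"
    using J_rho_type[OF _ _ assms(9), of 1] that by (simp add: M_def J\<rho>_def ma_elliptic_def)
  have hyp: "gen_almost_type M 1 \<epsilon>1 J\<rho>" if "ma_hyperbolic B \<alpha>"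
    using J_rho_type[OF _ _ assms(9), of "-1"] that by (simp add: M_def J\<rho>_def ma_hyperbolic_def)
  have neq: "\<not> gen_endo_eq M J\<alpha> J\<Omega>"
    unfolding M_def J\<alpha>_def J\<Omega>_def \<Omega>_def
    using assms(6) by (intro J_\<alpha>_neq_J_canonical) (simp add: smooth_manifold_def)
  have structI: "gen_almost_structure M J" if "gen_almost_type M \<gamma>1 \<gamma>2 J"
    "\<gamma>1 \<in> {-1, 1}" "\<gamma>2 \<in> {-1, 1}" for J \<gamma>1 \<gamma>2
    using that unfolding gen_almost_structure_def by blast
  have "gen_almost_structure M J\<alpha>" "gen_almost_structure M J\<Omega>"
    using structI[OF \<alpha>] structI[OF \<Omega>] assms(10,11) by auto
  moreover have "gen_almost_structure M J\<rho>" if "ma_elliptic B \<alpha> \<or> ma_hyperbolic B \<alpha>"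
    using that structI[OF ell] structI[OF hyp] assms(9) by auto
  ultimately show ?thesis
    using \<alpha> \<Omega> ell hyp neq by (auto simp: GaP_def GaPC_def GaC_def GaAC_def)
qed

end
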